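(* For every finite set $D\subset\{0,1\}^*$, $$\min_{x\in D}\mathbf{K}(x) < -\log\mathbf{m}(D)+\mathbf{I}(D:\mathcal{H})+O\big(\mathbf{K}(\lceil-\log \mathbf{m}(D)\rceil)+\log \mathbf{I}(D:\mathcal{H})\big),$$ where the constant in $O(\cdot)$ depends only on the universal machine $U$.
   Context: Finite binary strings are identified with natural numbers; $\|x\|$ is the length of $x$. $\langle x\rangle$ is a fixed self-delimiting encoding of $x$ (e.g. $1^{\|x\|}0x$), and a finite set $\{a_1,\dots,a_n\}$ is encoded as $\langle n\rangle\langle a_1\rangle\cdots\langle a_n\rangle$; complexity quantities of a finite set $D$ mean those of its encoding $\langle D\rangle$. $U$ is a fixed universal prefix-free machine with an auxiliary (conditional) input tape: $U_\alpha(p)$ is its output on program $p$ with auxiliary input $\alpha$ (a finite string or infinite sequence), and for every prefix-free machine $T$ there is a string $t$ with $U_\alpha(tp)=T_\alpha(p)$ for all $\alpha,p$. For $x\in\{0,1\}^*$ and auxiliary input $\alpha$, $x$ is called total for $U_\alpha$ if there is a finite prefix-free set $G$ with $\sum_{y\in G}2^{-\|y\|}=1$ such that $U_\alpha(xy)$ halts for every $y\in G$; $x$ is to the left of $y$ if for some string $z$, $z0$ is a prefix of $x$ and $z1$ a prefix of $y$. $U$ is assumed left-total: whenever $U_\alpha(y)$ halts and $x$ is to the left of $y$, $x$ is total for $U_\alpha$. $\mathbf{K}(x|y)=\min\{\|p\|:U_y(p)=x\}$, $\mathbf{K}(x)=\mathbf{K}(x|\emptyset)$. $\mathbf{m}(D)=\sum_{z}[U(z)\in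 D]\,2^{-\|z\|}$. The halting sequence $\mathcal{H}\in\{0,1\}^\infty$ has $i$-th bit $1$ iff $U(i)$ halts; $\mathbf{I}(x:\mathcal{H})=\mathbf{K}(x)-\mathbf{K}(x|\mathcal{H})$, where $\mathbf{K}(x|\mathcal{H})$ is the complexity with $\mathcal{H}$ on the auxiliary tape.
   Formalization: The equation U_α(tp)=T_α(p) contradicts left-totality; universality here means each T_α-program p for x has a U_α-program for x of length at most ‖p‖+c_T. In "total", U_α may halt on a prefix of xy. log I is read as log max(1,I); D is nonempty. *)

theory Defs
  imports "HOL-Analysis.Infinite_Sum" "HOL-Library.Sublist" "HOL-Library.Nat_Bijection"
begin

section \<open>Strings and natural numbers\<close>

type_synonym str = "bool list"

text \<open>The length-lexicographic identification: the empty string is 0, then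
  0, 1, 00, 01, ... are 1, 2, 3, 4, ...\<close>

definition nat_of_str :: "str \<Rightarrow> nat" where
  "nat_of_str x = foldl (\<lambda>n b. 2 * n + (if b then 2 else 1)) 0 x"

definition str_of_nat :: "nat \<Rightarrow> str" where
  "str_of_nat = inv nat_of_str"

lemma nat_of_str_snoc: "nat_of_str (x @ [b]) = 2 * nat_of_str x + (if b then 2 else 1)"
  by (simp add: nat_of_str_def)

lemma nat_of_str_Nil [simp]: "nat_of_str [] = 0"
  by (simp add: nat_of_str_def)

lemma nat_of_str_eq_0_iff [simp]: "nat_of_str x = 0 \<longleftrightarrow> x = []"
  by (cases x rule: rev_cases) (simp_all add: nat_of_str_snoc)

lemma bij_nat_of_str: "bij nat_of_str"
proof (rule bijI)
  show "inj nat_of_str"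
  proof (rule injI)
    show "x = y" if "nat_of_str x = nat_of_str y" for x y
      using that
    proof (induction x arbitrary: y rule: rev_induct)
      case Nil
      then show ?case by (metis nat_of_str_eq_0_iff)
    next
      case (snoc b x)
      have "nat_of_str (x @ [b]) \<noteq> 0" by simp
      with snoc.prems have "nat_of_str y \<noteq> 0" by argo
      then obtain y' b' where y: "y = y' @ [b']" by (cases y rule: rev_cases) auto
      have "2 * nat_of_str x + (if b then 2 else 1) = 2 * nat_of_str y' + (if b' then 2 else 1)"
        using snoc.prems by (simp add: y nat_of_str_snoc)
      then have "b = b'" "nat_of_str x = nat_of_str y'"
        by (cases b; cases b'; presburger)+
      with snoc.IH y show ?case by simp
    qed
  qed
  have "\<exists>x. nat_of_str x = n" for n
  proof (induction n rule: less_induct)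
    case (less n)
    show ?case
    proof (cases "n = 0")
      case False
      then have "(n - 1) div 2 < n" by linarith
      from less[OF this] obtain x where "nat_of_str x = (n - 1) div 2" ..
      with False have "nat_of_str (x @ [even n]) = n"
        by (simp add: nat_of_str_snoc) presburger
      then show ?thesis ..
    qed (use nat_of_str_Nil in blast)
  qed
  then show "surj nat_of_str" by (metis surjI)
qed

lemma str_of_nat_inverse [simp]: "nat_of_str (str_of_nat n) = n"
  unfolding str_of_nat_def by (simp add: bij_is_surj[OF bij_nat_of_str] surj_f_inv_f)

lemma nat_of_str_inverse [simp]: "str_of_nat (nat_of_str x) = x"
  unfolding str_of_nat_def by (simp add: bij_is_inj[OF bij_nat_of_str])

definition self_delim :: "str \<Rightarrow> str" where
  "self_delim x = replicate (length x) True @ False # x"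

text \<open>The elements of a finite set are listed in increasing order of the numbers they stand for.\<close>

definition encode_set :: "str set \<Rightarrow> str" where
  "encode_set D = self_delim (str_of_nat (card D)) @
     concat (map (\<lambda>n. self_delim (str_of_nat n)) (sorted_list_of_set (nat_of_str ` D)))"


section \<open>Partial computable functions with an oracle\<close>

text \<open>Programs for unary partial recursive functions, with several arguments packed by
  \<^const>\<open>prod_encode\<close>. \<open>Orc\<close> queries the oracle.\<close>

datatype prog =
    Zero | Succ | Fst | Snd | Orc
  | Tup prog prog
  | Comp prog prog
  | Prec prog prog
  | Rfind prog

definition minimize :: "(nat \<Rightarrow> nat option) \<Rightarrow> nat option" where
  "minimize f =
     (let found = (\<lambda>k. f k = Some 0 \<and> (\<forall>j<k. \<exists>v. f j = Some (Suc v)))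
      in if \<exists>k. found k then Some (THE k. found k) else None)"

primrec run :: "(nat \<Rightarrow> nat) \<Rightarrow> prog \<Rightarrow> nat \<Rightarrow> nat option" where
  "run \<phi> Zero = (\<lambda>n. Some 0)"
| "run \<phi> Succ = (\<lambda>n. Some (Suc n))"
| "run \<phi> Fst = (\<lambda>n. Some (fst (prod_decode n)))"
| "run \<phi> Snd = (\<lambda>n. Some (snd (prod_decode n)))"
| "run \<phi> Orc = (\<lambda>n. Some (\<phi> n))"
| "run \<phi> (Tup f g) = (\<lambda>n. Option.bind (run \<phi> f n)
     (\<lambda>a. Option.bind (run \<phi> g n) (\<lambda>b. Some (prod_encode (a, b)))))"
| "run \<phi> (Comp f g) = (\<lambda>n. Option.bind (run \<phi> g n) (run \<phi> f))"
| "run \<phi> (Prec f g) = (\<lambda>n. case prod_decode n of (a, m) \<Rightarrow>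
     rec_nat (run \<phi> f a)
       (\<lambda>k r. Option.bind r (\<lambda>v. run \<phi> g (prod_encode (a, prod_encode (k, v))))) m)"
| "run \<phi> (Rfind f) = (\<lambda>n. minimize (\<lambda>k. run \<phi> f (prod_encode (n, k))))"


section \<open>Prefix-free machines\<close>

text \<open>Contents of the auxiliary tape: a finite string or an infinite sequence. The oracle returns
  the symbol in the queried cell, 2 being the blank behind the end of a finite string.\<close>

datatype aux = Str str | Seq "nat \<Rightarrow> bool"

fun tape :: "aux \<Rightarrow> nat \<Rightarrow> nat" where
  "tape (Str y) i = (if i < length y then of_bool (y ! i) else 2)"
| "tape (Seq s) i = of_bool (s i)"

text \<open>\<open>T \<alpha> p\<close> is the output on program \<open>p\<close> with auxiliary input \<open>\<alpha>\<close>,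
  and \<^const>\<open>None\<close> if the computation does not halt.\<close>

type_synonym machine = "aux \<Rightarrow> str \<Rightarrow> str option"

definition computable :: "machine \<Rightarrow> bool" where
  "computable T \<longleftrightarrow>
     (\<exists>c. \<forall>\<alpha> p. map_option nat_of_str (T \<alpha> p) = run (tape \<alpha>) c (nat_of_str p))"

definition prefix_free :: "str set \<Rightarrow> bool" where
  "prefix_free G \<longleftrightarrow> (\<forall>x\<in>G. \<forall>y\<in>G. prefix x y \<longrightarrow> x = y)"

definition prefix_free_machine :: "machine \<Rightarrow> bool" where
  "prefix_free_machine T \<longleftrightarrow> computable T \<and> (\<forall>\<alpha>. prefix_free (dom (T \<alpha>)))"

text \<open>Universality by translation is incompatible with left-totality (see
  \<open>translation_universal_not_left_total\<close> below). The left-total machine obtained from a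
  translation-universal one is universal in the following, weaker sense, which is the one
  needed for the invariance of complexity.\<close>

definition translation_universal :: "machine \<Rightarrow> bool" where
  "translation_universal U \<longleftrightarrow> prefix_free_machine U \<and>
     (\<forall>T. prefix_free_machine T \<longrightarrow> (\<exists>t. \<forall>\<alpha> p. U \<alpha> (t @ p) = T \<alpha> p))"

definition universal :: "machine \<Rightarrow> bool" where
  "universal U \<longleftrightarrow> prefix_free_machine U \<and>
     (\<forall>T. prefix_free_machine T \<longrightarrow>
       (\<exists>c. \<forall>\<alpha> p x. T \<alpha> p = Some x \<longrightarrow> (\<exists>q. U \<alpha> q = Some x \<and> length q \<le> length p + c)))"

lemma translation_universal_imp_universal: "translation_universal U \<Longrightarrow> universal U"
  unfolding translation_universal_def universal_def
  by (metis add.commute dual_order.refl length_append)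


section \<open>Left-total machines\<close>

text \<open>A machine reads its program from a one-way tape and halts without looking beyond its last
  bit, so it halts on a tape beginning with \<open>w\<close>, within \<open>w\<close>, iff some prefix of \<open>w\<close> is in its
  domain. Asking for \<open>w\<close> itself to be in the domain would make a left-total prefix-free machine
  trivial (see \<open>strictly_left_total_trivial\<close> below): an extension of a halting program
  could never be total.\<close>

definition halts_on :: "machine \<Rightarrow> aux \<Rightarrow> str \<Rightarrow> bool" where
  "halts_on U \<alpha> w \<longleftrightarrow> (\<exists>p. prefix p w \<and> U \<alpha> p \<noteq> None)"

definition total_for :: "machine \<Rightarrow> aux \<Rightarrow> str \<Rightarrow> bool" where
  "total_for U \<alpha> x \<longleftrightarrow>
     (\<exists>G. finite G \<and> prefix_free G \<and> (\<Sum>y\<in>G. (1/2 :: real) ^ length y) = 1 \<and>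
          (\<forall>y\<in>G. halts_on U \<alpha> (x @ y)))"

definition left_of :: "str \<Rightarrow> str \<Rightarrow> bool" where
  "left_of x y \<longleftrightarrow> (\<exists>z. prefix (z @ [False]) x \<and> prefix (z @ [True]) y)"

definition left_total_machine :: "machine \<Rightarrow> bool" where
  "left_total_machine U \<longleftrightarrow> (\<forall>\<alpha> x y. U \<alpha> y \<noteq> None \<and> left_of x y \<longrightarrow> total_for U \<alpha> x)"

definition strictly_left_total :: "machine \<Rightarrow> bool" where
  "strictly_left_total U \<longleftrightarrow> (\<forall>\<alpha> x y. U \<alpha> y \<noteq> None \<and> left_of x y \<longrightarrow>
     (\<exists>G. finite G \<and> prefix_free G \<and> (\<Sum>y\<in>G. (1/2 :: real) ^ length y) = 1 \<and>
          (\<forall>y\<in>G. U \<alpha> (x @ y) \<noteq> None)))"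

lemma strictly_left_total_imp_left_total: "strictly_left_total U \<Longrightarrow> left_total_machine U"
  unfolding strictly_left_total_def left_total_machine_def total_for_def halts_on_def
  by (meson prefix_order.order_refl)

lemma strictly_left_total_trivial:
  assumes "prefix_free_machine U" "strictly_left_total U"
    and "U \<alpha> p \<noteq> None" "U \<alpha> q \<noteq> None"
  shows "p = q"
proof -
  have pf: "x = y" if "U \<alpha> x \<noteq> None" "U \<alpha> y \<noteq> None" "prefix x y" for x y
    using assms(1) that by (auto simp: prefix_free_machine_def prefix_free_def dom_def)
  have no_left: False if x: "U \<alpha> x \<noteq> None" and y: "U \<alpha> y \<noteq> None" and xy: "left_of x y" for x y
  proof -
    have "left_of (x @ [False]) y"
      using xy unfolding left_of_def by (meson prefix_prefix)
    then obtain G where G: "(\<Sum>y\<in>G. (1/2 :: real) ^ length y) = 1"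
      and halts: "\<forall>z\<in>G. U \<alpha> ((x @ [False]) @ z) \<noteq> None"
      using assms(2) y unfolding strictly_left_total_def by meson
    from G obtain z where "z \<in> G" by (cases "G = {}") auto
    with halts have "U \<alpha> ((x @ [False]) @ z) \<noteq> None" by blast
    then have "x = (x @ [False]) @ z" by (rule pf[OF x]) simp
    then show False by simp
  qed
  show ?thesis
  proof (rule ccontr)
    assume "p \<noteq> q"
    then have "parallel p q" using pf[OF assms(3,4)] pf[OF assms(4,3)] by auto
    from parallel_decomp[OF this]
    obtain z a b u v where "a \<noteq> b" "p = z @ a # u" "q = z @ b # v"
      by (elim exE conjE)
    then have "left_of p q \<or> left_of q p"
      unfolding left_of_def prefix_def by (cases a; cases b) auto
    then show False using no_left assms(3,4) by blast
  qed
qed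

lemma translation_universal_not_left_total:
  assumes "translation_universal U"
  shows "\<not> left_total_machine U"
proof
  assume lt: "left_total_machine U"
  define T :: machine where "T = (\<lambda>\<alpha> p. if p = [True] then Some [] else None)"
  define one where "one = Comp Succ Zero"
  define g where "g = Prec one (Comp (Prec Zero one) (Tup Zero (Comp Fst Snd)))"
  define f where "f = Comp (Prec one (Comp g (Tup Zero (Comp Fst Snd)))) (Tup Zero Fst)"
  have f: "run \<phi> f (prod_encode (n, k)) = Some (if n = 2 then 0 else 1)" for \<phi> n k
  proof -
    have const: "rec_nat (Some a) (\<lambda>k r. Option.bind r (\<lambda>v. Some (h k))) m =
        Some (case m of 0 \<Rightarrow> a | Suc j \<Rightarrow> h j)" for a :: nat and h m
      by (induction m) auto
    have "run \<phi> (Prec Zero one) (prod_encode (0, j)) = Some (if j = 0 then 0 else 1)" for j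
      by (simp add: one_def) (subst const, auto split: nat.split)
    then have "run \<phi> g (prod_encode (0, j)) = Some (if j = 1 then 0 else 1)" for j
      by (simp add: g_def one_def del: run.simps(8)) (simp, subst const, auto split: nat.split)
    then show ?thesis
      by (simp add: f_def one_def) (subst const, auto split: nat.split)
  qed
  have "map_option nat_of_str (T \<alpha> p) = run (tape \<alpha>) (Rfind f) (nat_of_str p)" for \<alpha> p
  proof -
    have "nat_of_str p = 2 \<longleftrightarrow> p = [True]"
      using inj_eq[OF bij_is_inj[OF bij_nat_of_str], of p "[True]"] by (simp add: nat_of_str_def)
    then show ?thesis by (auto simp: f T_def minimize_def)
  qed
  then have "computable T" unfolding computable_def by blast
  then have "prefix_free_machine T"
    by (auto simp: prefix_free_machine_def prefix_free_def T_def dom_def split: if_splits)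
  then obtain t where t: "U \<alpha> (t @ p) = T \<alpha> p" for \<alpha> p
    using assms unfolding translation_universal_def by metis
  have pf: "prefix_free (dom (U \<alpha>))" for \<alpha>
    using assms by (simp add: translation_universal_def prefix_free_machine_def)
  define \<alpha> where "\<alpha> = Str []"
  have t1: "U \<alpha> (t @ [True]) \<noteq> None" by (simp add: t T_def)
  moreover have "left_of (t @ [False]) (t @ [True])" unfolding left_of_def by blast
  ultimately obtain G where G: "(\<Sum>y\<in>G. (1/2 :: real) ^ length y) = 1"
    and halts: "\<forall>y\<in>G. halts_on U \<alpha> ((t @ [False]) @ y)"
    using lt unfolding left_total_machine_def total_for_def by meson
  from G obtain y where "y \<in> G" by (cases "G = {}") auto
  with halts obtain q where q: "prefix q (t @ False # y)" "U \<alpha> q \<noteq> None"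
    unfolding halts_on_def by auto
  show False
  proof (cases "prefix q t")
    case True
    then have "prefix q (t @ [True])" by simp
    then have "q = t @ [True]" using pf[of \<alpha>] t1 q(2) unfolding prefix_free_def
      by (blast intro: domI)
    with True show False by simp
  next
    case False
    then obtain r where r: "q = t @ r" "prefix r (False # y)" "r \<noteq> []"
      using q(1) by (auto simp: prefix_append)
    then have "r \<noteq> [True]" by auto
    then have "U \<alpha> q = None" using t r(1) by (simp add: T_def)
    with q(2) show False ..
  qed
qed


section \<open>Complexity, algorithmic probability, information about the halting sequence\<close>

text \<open>For a universal machine the set below is never empty.\<close>

definition Kc :: "machine \<Rightarrow> str \<Rightarrow> aux \<Rightarrow> nat" where
  "Kc U x \<alpha> = Inf {length p | p. U \<alpha> p = Some x}"

definition K :: "machine \<Rightarrow> str \<Rightarrow> nat" where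
  "K U x = Kc U x (Str [])"

text \<open>The family is summable for a prefix-free machine, by Kraft's inequality.\<close>

definition m_prob :: "machine \<Rightarrow> str set \<Rightarrow> real" where
  "m_prob U D = (\<Sum>\<^sub>\<infinity>z\<in>{z. \<exists>x\<in>D. U (Str []) z = Some x}. (1/2) ^ length z)"

definition halting_seq :: "machine \<Rightarrow> nat \<Rightarrow> bool" where
  "halting_seq U i \<longleftrightarrow> U (Str []) (str_of_nat i) \<noteq> None"

definition I_halt :: "machine \<Rightarrow> str \<Rightarrow> int" where
  "I_halt U x = int (K U x) - int (Kc U x (Seq (halting_seq U)))"

text \<open>The logarithm of an information quantity, which may be zero or a negative constant, is
  cut off at 0.\<close>

definition log_plus :: "int \<Rightarrow> real" where
  "log_plus i = log 2 (max 1 (real_of_int i))"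

end

theory Submission
  imports Defs
begin

text \<open>
  Approximate from below the weight of the programs \<open>p\<close> that print the code of a set \<open>D\<close> which has
  received half of its probability \<open>2\<^sup>-\<^sup>i\<close>. For a shortest program \<open>p\<close> of \<open>D\<close>, let \<open>2\<^sup>-\<^sup>n\<close> be about
  the weight enumerated from \<open>p\<close> on. A stage \<open>t\<close> after that is determined, up to logarithmic terms, by
  \<open>i\<close> and the first \<open>n\<close> bits of the total weight.

  On the one hand, the halting sequence finds such a stage from \<open>n\<close> and \<open>i\<close>, since the halting times of
  short programs dominate it; among the last \<open>2\<^sup>-\<^sup>n\<close> of the weight, \<open>p\<close> can be described with
  \<open>n\<close> bits less. Hence \<open>n\<close> is at most about \<open>I(D : H)\<close>.

  On the other hand, given \<open>t\<close>, a greedy choice yields a set \<open>W\<close> of about \<open>2\<^sup>i d\<close> strings that meets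
  all enumerated sets except for programs of weight \<open>2\<^sup>-\<^sup>d\<close>. With \<open>d\<close> slightly larger than the
  complexity of \<open>(t, i)\<close>, missing \<open>D\<close> would compress \<open>p\<close>, so \<open>W\<close> meets \<open>D\<close>, and
  elements of \<open>W\<close> have complexity about \<open>i + n\<close>.
\<close>

section \<open>Total computable functions\<close>

text \<open>The stage \<open>t\<close> must come after \<open>p\<close> and still be cheap. For
  given \<open>n\<close> and \<open>i\<close> the truncation of the enumerated weight to
  \<open>n + 1\<close> digits can jump at most 2^(n+1) times, so the stages of its jumps are cheap,
  and \<open>n\<close> is chosen so that a jump occurs once \<open>p\<close> has appeared. A cheap
  stage cannot have settled all programs of length about 4n + 2i, since it would then compute a
  number more complex than itself; so the first settled stage, which is computable from the halting
  sequence, comes later still and has seen \<open>p\<close>.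

  The size of \<open>W\<close> comes from averaging: an enumerated set has probability at least
  2^-(i+1) among the outputs seen so far, so 2^(i+1) choices halve the missed weight and
  \<open>d\<close> rounds leave 2^-d. The number \<open>d\<close> refers to the length of the very
  program that describes the stage; a decoder reads this length off, so \<open>d\<close> costs only
  its logarithm.

  Every description arises from a computable list of requests. A bound on complexity thus amounts to
  the computability of the list and to a bound 1 on its total weight, which is why closure
  properties of total computable functions come first.\<close>

definition pair :: "nat \<Rightarrow> nat \<Rightarrow> nat" where
  "pair a b = prod_encode (a, b)"

definition p1 :: "nat \<Rightarrow> nat" where
  "p1 n = fst (prod_decode n)"

definition p2 :: "nat \<Rightarrow> nat" where
  "p2 n = snd (prod_decode n)"

lemma p1_pair [simp]: "p1 (pair a b) = a"
  and p2_pair [simp]: "p2 (pair a b) = b"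
  and pair_p1_p2 [simp]: "pair (p1 n) (p2 n) = n"
  by (simp_all add: pair_def p1_def p2_def)

lemma pair_eq_iff [simp]: "pair a b = pair a' b' \<longleftrightarrow> a = a' \<and> b = b'"
  by (simp add: pair_def)

text \<open>The second argument is an environment: local variables are packed by \<^const>\<open>pair\<close>,
  so that closure under a binder amounts to a premise about a one-argument function.\<close>

definition tc :: "((nat \<Rightarrow> nat) \<Rightarrow> nat \<Rightarrow> nat) \<Rightarrow> bool" where
  "tc f \<longleftrightarrow> (\<exists>c. \<forall>\<phi> n. run \<phi> c n = Some (f \<phi> n))"

definition dec :: "((nat \<Rightarrow> nat) \<Rightarrow> nat \<Rightarrow> bool) \<Rightarrow> bool" where
  "dec P \<longleftrightarrow> tc (\<lambda>\<phi> n. of_bool (P \<phi> n))"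

named_theorems tc_intros

lemma tc_id [tc_intros]: "tc (\<lambda>\<phi> n. n)"
  unfolding tc_def by (rule exI[of _ "Tup Fst Snd"]) simp

lemma tc_comp:
  assumes "tc f" "tc g"
  shows "tc (\<lambda>\<phi> n. f \<phi> (g \<phi> n))"
proof -
  obtain c d where "\<forall>\<phi> n. run \<phi> c n = Some (f \<phi> n)" "\<forall>\<phi> n. run \<phi> d n = Some (g \<phi> n)"
    using assms unfolding tc_def by blast
  then show ?thesis unfolding tc_def by (intro exI[of _ "Comp c d"]) simp
qed

lemma tc_Suc [tc_intros]: "tc f \<Longrightarrow> tc (\<lambda>\<phi> n. Suc (f \<phi> n))"
  by (rule tc_comp[of "\<lambda>\<phi>. Suc"]) (auto simp: tc_def intro: exI[of _ Succ])

lemma tc_const [tc_intros]: "tc (\<lambda>\<phi> n. k)"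
proof (induction k)
  case 0
  show ?case by (auto simp: tc_def intro: exI[of _ Zero])
qed (rule tc_Suc)

lemma tc_p1 [tc_intros]: "tc f \<Longrightarrow> tc (\<lambda>\<phi> n. p1 (f \<phi> n))"
  by (rule tc_comp[of "\<lambda>\<phi>. p1"]) (auto simp: tc_def p1_def intro: exI[of _ Fst])

lemma tc_p2 [tc_intros]: "tc f \<Longrightarrow> tc (\<lambda>\<phi> n. p2 (f \<phi> n))"
  by (rule tc_comp[of "\<lambda>\<phi>. p2"]) (auto simp: tc_def p2_def intro: exI[of _ Snd])

lemma tc_oracle [tc_intros]: "tc f \<Longrightarrow> tc (\<lambda>\<phi> n. \<phi> (f \<phi> n))"
  by (rule tc_comp[of "\<lambda>\<phi>. \<phi>"]) (auto simp: tc_def intro: exI[of _ Orc])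

lemma tc_pair [tc_intros]:
  assumes "tc f" "tc g"
  shows "tc (\<lambda>\<phi> n. pair (f \<phi> n) (g \<phi> n))"
proof -
  obtain c d where "\<forall>\<phi> n. run \<phi> c n = Some (f \<phi> n)" "\<forall>\<phi> n. run \<phi> d n = Some (g \<phi> n)"
    using assms unfolding tc_def by blast
  then show ?thesis unfolding tc_def pair_def by (intro exI[of _ "Tup c d"]) simp
qed

lemma tc_comp2:
  assumes "tc (\<lambda>\<phi> e. f \<phi> (p1 e) (p2 e))" "tc g" "tc h"
  shows "tc (\<lambda>\<phi> n. f \<phi> (g \<phi> n) (h \<phi> n))"
  using tc_comp[OF assms(1) tc_pair[OF assms(2,3)]] by simp

lemma tc_rec_nat [tc_intros]:
  assumes "tc a" "tc (\<lambda>\<phi> e. h \<phi> (p1 e) (p1 (p2 e)) (p2 (p2 e)))" "tc m"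
  shows "tc (\<lambda>\<phi> n. rec_nat (a \<phi> n) (\<lambda>k r. h \<phi> n k r) (m \<phi> n))"
proof -
  obtain ca ch where ca: "run \<phi> ca n = Some (a \<phi> n)"
    and ch: "run \<phi> ch e = Some (h \<phi> (p1 e) (p1 (p2 e)) (p2 (p2 e)))" for \<phi> n e
    using assms(1,2) unfolding tc_def by meson
  have "rec_nat (run \<phi> ca n)
          (\<lambda>k r. Option.bind r (\<lambda>v. run \<phi> ch (pair n (pair k v)))) k =
        Some (rec_nat (a \<phi> n) (\<lambda>k r. h \<phi> n k r) k)" for \<phi> n k
    by (induction k) (simp_all add: ca ch)
  then have "run \<phi> (Prec ca ch) (pair n k) = Some (rec_nat (a \<phi> n) (\<lambda>k r. h \<phi> n k r) k)" for \<phi> n k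
    by (simp add: pair_def)
  then have "run \<phi> (Prec ca ch) e = Some (rec_nat (a \<phi> (p1 e)) (\<lambda>k r. h \<phi> (p1 e) k r) (p2 e))"
    for \<phi> e
    by (metis pair_p1_p2)
  then have "tc (\<lambda>\<phi> e. rec_nat (a \<phi> (p1 e)) (\<lambda>k r. h \<phi> (p1 e) k r) (p2 e))"
    unfolding tc_def by blast
  from tc_comp2[of "\<lambda>\<phi> n k. rec_nat (a \<phi> n) (\<lambda>k r. h \<phi> n k r) k", OF this tc_id assms(3)]
  show ?thesis by simp
qed

lemma tc_add [tc_intros]:
  assumes "tc f" "tc g"
  shows "tc (\<lambda>\<phi> n. f \<phi> n + g \<phi> n)"
proof -
  have "a + b = rec_nat a (\<lambda>k r. Suc r) b" for a b :: nat
    by (induction b) simp_all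
  then show ?thesis by (simp only:) (intro tc_intros assms)
qed

lemma tc_mult [tc_intros]:
  assumes "tc f" "tc g"
  shows "tc (\<lambda>\<phi> n. f \<phi> n * g \<phi> n)"
proof -
  have "a * b = rec_nat 0 (\<lambda>k r. r + a) b" for a b :: nat
    by (induction b) simp_all
  \<comment> \<open>Inside the recursion the environment is extended by the counter and the previous
    value; \<open>tc_comp\<close> evaluates the factor at its old part.\<close>
  then show ?thesis by (simp only:) (intro tc_intros assms tc_comp[OF assms(1)])
qed

lemma tc_power [tc_intros]:
  assumes "tc f" "tc g"
  shows "tc (\<lambda>\<phi> n. f \<phi> n ^ g \<phi> n)"
proof -
  have "a ^ b = rec_nat 1 (\<lambda>k r. r * a) b" for a b :: nat
    by (induction b) simp_all
  then show ?thesis by (simp only:) (intro tc_intros assms tc_comp[OF assms(1)])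
qed

lemma tc_diff [tc_intros]:
  assumes "tc f" "tc g"
  shows "tc (\<lambda>\<phi> n. f \<phi> n - g \<phi> n)"
proof -
  have "n - 1 = rec_nat 0 (\<lambda>k r. k) n" for n :: nat
    by (cases n) simp_all
  moreover have "a - b = rec_nat a (\<lambda>k r. r - 1) b" for a b :: nat
    by (induction b) simp_all
  ultimately have *: "a - b = rec_nat a (\<lambda>k r. rec_nat 0 (\<lambda>k r. k) r) b" for a b :: nat
    by presburger
  show ?thesis unfolding * by (intro tc_intros assms)
qed

lemma dec_tc [tc_intros]: "dec P \<Longrightarrow> tc (\<lambda>\<phi> n. of_bool (P \<phi> n))"
  by (simp add: dec_def)

lemma dec_le [tc_intros]:
  assumes "tc f" "tc g"
  shows "dec (\<lambda>\<phi> n. f \<phi> n \<le> g \<phi> n)"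
proof -
  have "of_bool (a \<le> b) = 1 - (a - b)" for a b :: nat by simp
  then show ?thesis unfolding dec_def by (simp only:) (intro tc_intros assms)
qed

lemma dec_less [tc_intros]: "tc f \<Longrightarrow> tc g \<Longrightarrow> dec (\<lambda>\<phi> n. f \<phi> n < g \<phi> n)"
  unfolding less_eq_Suc_le by (intro tc_intros)

lemma dec_not [tc_intros]:
  assumes "dec P"
  shows "dec (\<lambda>\<phi> n. \<not> P \<phi> n)"
proof -
  have "of_bool (\<not> a) = 1 - (of_bool a :: nat)" for a by simp
  then show ?thesis unfolding dec_def by (simp only:) (intro tc_intros assms)
qed

lemma dec_conj [tc_intros]:
  assumes "dec P" "dec Q"
  shows "dec (\<lambda>\<phi> n. P \<phi> n \<and> Q \<phi> n)"
  unfolding dec_def of_bool_conj by (intro tc_intros assms)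

lemma dec_disj [tc_intros]:
  assumes "dec P" "dec Q"
  shows "dec (\<lambda>\<phi> n. P \<phi> n \<or> Q \<phi> n)"
proof -
  have "dec (\<lambda>\<phi> n. \<not> (\<not> P \<phi> n \<and> \<not> Q \<phi> n))" by (intro tc_intros assms)
  then show ?thesis by simp
qed

lemma dec_imp [tc_intros]:
  assumes "dec P" "dec Q"
  shows "dec (\<lambda>\<phi> n. P \<phi> n \<longrightarrow> Q \<phi> n)"
  unfolding imp_conv_disj by (intro tc_intros assms)

lemma dec_eq [tc_intros]:
  assumes "tc f" "tc g"
  shows "dec (\<lambda>\<phi> n. f \<phi> n = g \<phi> n)"
  unfolding order.eq_iff by (intro tc_intros assms)

lemma tc_if [tc_intros]:
  assumes "dec P" "tc f" "tc g"
  shows "tc (\<lambda>\<phi> n. if P \<phi> n then f \<phi> n else g \<phi> n)"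
proof -
  have "(if a then b else c) = of_bool a * b + of_bool (\<not> a) * c" for a and b c :: nat by simp
  then show ?thesis by (simp only:) (intro tc_intros assms)
qed

lemma tc_sum [tc_intros]:
  assumes "tc (\<lambda>\<phi> e. f \<phi> (p1 e) (p2 e))" "tc m"
  shows "tc (\<lambda>\<phi> n. \<Sum>k<m \<phi> n. f \<phi> n k)"
proof -
  have *: "(\<Sum>k<m. g k) = rec_nat 0 (\<lambda>k r. r + g k) m" for m and g :: "nat \<Rightarrow> nat"
    by (induction m) simp_all
  show ?thesis unfolding *
    by (intro tc_intros assms tc_comp2[OF assms(1)])
qed

lemma dec_ball [tc_intros]:
  assumes "dec (\<lambda>\<phi> e. P \<phi> (p1 e) (p2 e))" "tc m"
  shows "dec (\<lambda>\<phi> n. \<forall>k<m \<phi> n. P \<phi> n k)"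
proof -
  have *: "(\<forall>k<m. Q k) \<longleftrightarrow> (\<Sum>k<m. of_bool (\<not> Q k) :: nat) = 0" for Q and m :: nat
    by (auto simp del: sum_of_bool_eq)
  show ?thesis unfolding *
    by (intro tc_intros assms)
qed

lemma dec_bex [tc_intros]:
  assumes "dec (\<lambda>\<phi> e. P \<phi> (p1 e) (p2 e))" "tc m"
  shows "dec (\<lambda>\<phi> n. \<exists>k<m \<phi> n. P \<phi> n k)"
proof -
  have "dec (\<lambda>\<phi> n. \<not> (\<forall>k<m \<phi> n. \<not> P \<phi> n k))" by (intro tc_intros assms)
  then show ?thesis by simp
qed

text \<open>Division as a count of the \<open>k < a\<close> with \<open>b * Suc k \<le> a\<close>,
  which needs bounded sums only. For \<open>b = 0\<close> the count would be \<open>a\<close>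
  instead of 0, hence the case distinction.\<close>

lemma tc_div [tc_intros]:
  assumes "tc f" "tc g"
  shows "tc (\<lambda>\<phi> n. f \<phi> n div g \<phi> n)"
proof -
  have "(\<Sum>k<a. of_bool (b * Suc k \<le> a)) = a div b" if "b > 0" for a b :: nat
  proof -
    have "{..<a} \<inter> {k. b * Suc k \<le> a} = {..<a div b}"
    proof (intro set_eqI iffI)
      fix k assume "k \<in> {..<a div b}"
      then have "Suc k \<le> a div b" by simp
      then have *: "Suc k * b \<le> a" using \<open>b > 0\<close> less_eq_div_iff_mult_less_eq by blast
      moreover have "Suc k \<le> Suc k * b" using mult_le_mono2[of 1 b "Suc k"] \<open>b > 0\<close> by simp
      ultimately have "k < a" by linarith
      with * show "k \<in> {..<a} \<inter> {k. b * Suc k \<le> a}" by (simp add: mult.commute)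
    next
      fix k assume "k \<in> {..<a} \<inter> {k. b * Suc k \<le> a}"
      then have "Suc k * b \<le> a" by (simp add: mult.commute)
      then have "Suc k \<le> a div b" using \<open>b > 0\<close> less_eq_div_iff_mult_less_eq by blast
      then show "k \<in> {..<a div b}" by simp
    qed
    then show ?thesis by (simp add: of_bool_def sum.If_cases)
  qed
  then have *: "a div b = (if 0 < b then \<Sum>k<a. of_bool (b * Suc k \<le> a) else 0)" for a b :: nat
    by simp
  show ?thesis unfolding *
    by (intro tc_intros assms tc_comp[OF assms(1)] tc_comp[OF assms(2)])
qed

lemma dec_odd [tc_intros]:
  assumes "tc f"
  shows "dec (\<lambda>\<phi> n. odd (f \<phi> n))"
proof -
  have *: "odd a \<longleftrightarrow> a = 2 * (a div 2) + 1" for a :: nat by presburger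
  show ?thesis by (subst *) (intro tc_intros assms)
qed

text \<open>The common form of all machines built below: search for the least witness of a decidable
  relation, then compute the output from it. Divergence is the absence of a witness.\<close>

lemma computable_search:
  assumes P: "dec (\<lambda>\<phi> e. P \<phi> (p1 e) (p2 e))" and g: "tc (\<lambda>\<phi> e. g \<phi> (p1 e) (p2 e))"
    and T: "\<And>\<alpha> p. map_option nat_of_str (T \<alpha> p) =
      (if \<exists>t. P (tape \<alpha>) (nat_of_str p) t
       then Some (g (tape \<alpha>) (nat_of_str p) (LEAST t. P (tape \<alpha>) (nat_of_str p) t)) else None)"
  shows "computable T"
proof -
  obtain cP where cP: "run \<phi> cP e = Some (of_bool (\<not> P \<phi> (p1 e) (p2 e)))" for \<phi> e
    using dec_not[OF P] unfolding dec_def tc_def by blast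
  obtain cg where cg: "run \<phi> cg e = Some (g \<phi> (p1 e) (p2 e))" for \<phi> e
    using g unfolding tc_def by blast
  obtain ci where ci: "run \<phi> ci n = Some n" for \<phi> n
    using tc_id unfolding tc_def by blast
  define c where "c = Comp cg (Tup ci (Rfind cP))"
  have found: "(of_bool (\<not> Q k) = (0::nat) \<and> (\<forall>j<k. \<exists>v. of_bool (\<not> Q j) = Suc v)) \<longleftrightarrow>
      k = (LEAST t. Q t) \<and> Q k" for Q and k :: nat
  proof -
    have "(\<forall>j<k. \<exists>v. of_bool (\<not> Q j) = Suc v) \<longleftrightarrow> (\<forall>j<k. \<not> Q j)" by auto
    moreover have "Q k \<and> (\<forall>j<k. \<not> Q j) \<longleftrightarrow> k = (LEAST t. Q t) \<and> Q k"
      by (metis Least_equality leI not_less_Least)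
    ultimately show ?thesis by auto
  qed
  have mini: "minimize (\<lambda>k. Some (of_bool (\<not> Q k))) =
      (if \<exists>k. Q k then Some (LEAST k. Q k) else None)" for Q
  proof (cases "\<exists>k. Q k")
    case True
    then have "Q (LEAST k. Q k)" by (rule LeastI_ex)
    then show ?thesis unfolding minimize_def Let_def option.inject found
      using True by auto
  next
    case False
    then show ?thesis unfolding minimize_def Let_def option.inject found by auto
  qed
  have "run \<phi> (Rfind cP) n = (if \<exists>k. P \<phi> n k then Some (LEAST k. P \<phi> n k) else None)" for \<phi> n
    using mini[of "P \<phi> n"] by (simp add: cP flip: pair_def)
  then have "run \<phi> c n = (if \<exists>t. P \<phi> n t then Some (g \<phi> n (LEAST t. P \<phi> n t)) else None)" for \<phi> n
    unfolding c_def
    by (simp add: ci cg flip: pair_def del: run.simps(9))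
  then show ?thesis unfolding computable_def using T by metis
qed

section \<open>Bounded simulation\<close>

text \<open>The value is 0 while the computation has not halted, and the successor of the output
  afterwards. The oracle is the empty tape.\<close>

primrec stp :: "prog \<Rightarrow> nat \<Rightarrow> nat \<Rightarrow> nat" where
  "stp Zero n t = Suc 0"
| "stp Succ n t = Suc (Suc n)"
| "stp Fst n t = Suc (p1 n)"
| "stp Snd n t = Suc (p2 n)"
| "stp Orc n t = Suc 2"
| "stp (Tup f g) n t = (if stp f n t = 0 \<or> stp g n t = 0 then 0
     else Suc (pair (stp f n t - 1) (stp g n t - 1)))"
| "stp (Comp f g) n t = (if stp g n t = 0 then 0 else stp f (stp g n t - 1) t)"
| "stp (Prec f g) n t = rec_nat (stp f (p1 n) t)
     (\<lambda>k r. if r = 0 then 0 else stp g (pair (p1 n) (pair k (r - 1))) t) (p2 n)"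
| "stp (Rfind f) n t = (\<Sum>k<t. if stp f (pair n k) t = 1 \<and> (\<forall>j<k. 2 \<le> stp f (pair n j) t)
     then Suc k else 0)"

lemma tc_stp:
  "tc f \<Longrightarrow> tc g \<Longrightarrow> tc (\<lambda>\<phi> n. stp c (f \<phi> n) (g \<phi> n))"
proof (induction c arbitrary: f g)
  case (Prec c d)
  show ?case unfolding stp.simps
    by (intro tc_intros Prec tc_comp[OF Prec.prems(2)] tc_comp[OF Prec.prems(1)])
next
  case (Rfind c)
  show ?case unfolding stp.simps
    by (intro tc_intros Rfind tc_comp[OF Rfind.prems(2)] tc_comp[OF Rfind.prems(1)])
next
  case (Tup c d)
  show ?case unfolding stp.simps by (intro tc_intros Tup)
next
  case (Comp c d)
  show ?case unfolding stp.simps by (intro tc_intros Comp)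
qed (unfold stp.simps, (intro tc_intros; assumption)+)

text \<open>The defining sum is a search below \<open>t\<close> in disguise: value 1 at
  \<open>k\<close> (halted with output 0) excludes every later candidate, which needs a value at
  least 2 there, so at most one term is nonzero.\<close>

lemma stp_Rfind_eq_Suc:
  "stp (Rfind f) n t = Suc k \<longleftrightarrow>
    k < t \<and> stp f (pair n k) t = 1 \<and> (\<forall>j<k. 2 \<le> stp f (pair n j) t)"
proof -
  define Q where "Q = (\<lambda>k. stp f (pair n k) t = 1 \<and> (\<forall>j<k. 2 \<le> stp f (pair n j) t))"
  then have Q: "stp f (pair n k) t = 1 \<and> (\<forall>j<k. 2 \<le> stp f (pair n j) t) \<longleftrightarrow> Q k" for k
    by simp
  have sum: "stp (Rfind f) n t = Suc k" if "k < t" "Q k" for k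
  proof -
    have "Q j \<longleftrightarrow> j = k" for j
      using that(2) unfolding Q_def
      by (metis linorder_neqE_nat numeral_le_one_iff semiring_norm(69))
    then show ?thesis using that(1) by (simp only: stp.simps Q) simp
  qed
  have "\<exists>k<t. Q k" if "stp (Rfind f) n t \<noteq> 0"
    using that unfolding stp.simps Q
    by (auto split: if_splits elim!: sum.not_neutral_contains_not_neutral)
  with sum show ?thesis unfolding Q by (metis nat.inject nat.distinct(1))
qed

lemma stp_mono:
  "stp c n t = Suc v \<Longrightarrow> t \<le> t' \<Longrightarrow> stp c n t' = Suc v"
proof (induction c arbitrary: n v)
  case (Tup f g)
  then show ?case by (auto split: if_splits simp: gr0_conv_Suc)
next
  case (Comp f g)
  then show ?case by (auto split: if_splits simp: gr0_conv_Suc)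
next
  case (Prec f g)
  define a where "a = p1 n"
  have "rec_nat (stp f a t) (\<lambda>k r. if r = 0 then 0 else stp g (pair a (pair k (r - 1))) t) m = Suc v \<Longrightarrow>
    rec_nat (stp f a t') (\<lambda>k r. if r = 0 then 0 else stp g (pair a (pair k (r - 1))) t') m = Suc v" for m v
  proof (induction m arbitrary: v)
    case 0
    then show ?case using Prec by simp
  next
    case (Suc m)
    then show ?case using Prec.IH(2) Prec.prems(2)
      by (cases "rec_nat (stp f a t) (\<lambda>k r. if r = 0 then 0 else stp g (pair a (pair k (r - 1))) t) m") simp_all
  qed
  from this[of "p2 n" v, unfolded a_def] show ?case using Prec.prems(1) unfolding stp.simps a_def by blast
next
  case (Rfind f)
  have "2 \<le> stp f (pair n j) t'" if "2 \<le> stp f (pair n j) t" for j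
    using that Rfind.IH[of "pair n j" "stp f (pair n j) t - 1"] Rfind.prems(2) by fastforce
  then show ?case
    using Rfind.IH[of "pair n v" 0] Rfind.prems unfolding stp_Rfind_eq_Suc by auto
qed simp_all

lemma minimize_eq_Some:
  "minimize f = Some k \<longleftrightarrow> f k = Some 0 \<and> (\<forall>j<k. \<exists>v. f j = Some (Suc v))"
proof -
  define Q where "Q = (\<lambda>k. f k = Some 0 \<and> (\<forall>j<k. \<exists>v. f j = Some (Suc v)))"
  have uniq: "i = j" if "Q i" "Q j" for i j
    using that unfolding Q_def
    by (metis Suc_neq_Zero linorder_neqE_nat option.inject)
  then have the: "(THE k. Q k) = k" if "Q k" for k using that by blast
  have "minimize f = (if \<exists>k. Q k then Some (THE k. Q k) else None)"
    by (simp add: minimize_def Q_def Let_def)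
  then have "minimize f = Some k \<longleftrightarrow> Q k" using the by auto
  then show ?thesis unfolding Q_def .
qed

lemma stp_sound:
  "stp c n t = Suc v \<Longrightarrow> run (\<lambda>_. 2) c n = Some v"
proof (induction c arbitrary: n v)
  case (Tup f g)
  then show ?case by (auto split: if_splits simp: gr0_conv_Suc pair_def)
next
  case (Comp f g)
  then show ?case by (auto split: if_splits simp: gr0_conv_Suc)
next
  case (Prec f g)
  define a where "a = p1 n"
  have "rec_nat (stp f a t) (\<lambda>k r. if r = 0 then 0 else stp g (pair a (pair k (r - 1))) t) m = Suc v \<Longrightarrow>
    rec_nat (run (\<lambda>_. 2) f a)
      (\<lambda>k r. Option.bind r (\<lambda>v. run (\<lambda>_. 2) g (pair a (pair k v)))) m = Some v" for m v
  proof (induction m arbitrary: v)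
    case 0
    then show ?case using Prec by simp
  next
    case (Suc m)
    then show ?case using Prec.IH(2)
      by (cases "rec_nat (stp f a t) (\<lambda>k r. if r = 0 then 0 else stp g (pair a (pair k (r - 1))) t) m") simp_all
  qed
  from this[of "p2 n" v, unfolded a_def] show ?case
    using Prec.prems(1) by (simp add: p1_def p2_def pair_def case_prod_unfold)
next
  case (Rfind f)
  have "\<exists>w. run (\<lambda>_. 2) f (pair n j) = Some (Suc w)" if "2 \<le> stp f (pair n j) t" for j
    using that Rfind.IH[of "pair n j" "Suc (stp f (pair n j) t - 2)"] by fastforce
  then show ?case
    using Rfind.IH[of "pair n v" 0] Rfind.prems
    unfolding stp_Rfind_eq_Suc run.simps minimize_eq_Some pair_def[symmetric] by auto
qed (simp_all add: p1_def p2_def)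

text \<open>A halting computation has finitely many subcomputations, and \<open>eventually\<close>
  combines their stages without naming a common bound. For \<open>Rfind\<close> the stage must also
  exceed the result \<open>v\<close>.\<close>

lemma eventually_stp:
  "run (\<lambda>_. 2) c n = Some v \<Longrightarrow> \<forall>\<^sub>F t in sequentially. stp c n t = Suc v"
proof (induction c arbitrary: n v)
  case (Tup f g)
  then obtain a b where *: "run (\<lambda>_. 2) f n = Some a" "run (\<lambda>_. 2) g n = Some b" "v = pair a b"
    by (auto simp: bind_eq_Some_conv pair_def)
  from Tup.IH(1)[OF *(1)] Tup.IH(2)[OF *(2)] show ?case
    by eventually_elim (simp add: *(3))
next
  case (Comp f g)
  then obtain a where *: "run (\<lambda>_. 2) g n = Some a" "run (\<lambda>_. 2) f a = Some v"
    by (auto simp: bind_eq_Some_conv)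
  from Comp.IH(1)[OF *(2)] Comp.IH(2)[OF *(1)] show ?case
    by eventually_elim simp
next
  case (Prec f g)
  define a where "a = p1 n"
  have "rec_nat (run (\<lambda>_. 2) f a)
      (\<lambda>k r. Option.bind r (\<lambda>v. run (\<lambda>_. 2) g (pair a (pair k v)))) m = Some v \<Longrightarrow>
    \<forall>\<^sub>F t in sequentially. rec_nat (stp f a t)
      (\<lambda>k r. if r = 0 then 0 else stp g (pair a (pair k (r - 1))) t) m = Suc v" for m v
  proof (induction m arbitrary: v)
    case 0
    then show ?case using Prec by simp
  next
    case (Suc m)
    then obtain w where *: "rec_nat (run (\<lambda>_. 2) f a)
      (\<lambda>k r. Option.bind r (\<lambda>v. run (\<lambda>_. 2) g (pair a (pair k v)))) m = Some w"
      "run (\<lambda>_. 2) g (pair a (pair m w)) = Some v"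
      by (auto simp: bind_eq_Some_conv)
    from Suc.IH[OF *(1)] Prec.IH(2)[OF *(2)] show ?case
      by eventually_elim simp
  qed
  from this[of "p2 n" v, unfolded a_def] show ?case
    using Prec.prems(1) by (simp add: p1_def p2_def pair_def case_prod_unfold)
next
  case (Rfind f)
  then have v: "run (\<lambda>_. 2) f (pair n v) = Some 0"
    and lt: "\<forall>j\<in>{..<v}. \<exists>w. run (\<lambda>_. 2) f (pair n j) = Some (Suc w)"
    by (auto simp: minimize_eq_Some pair_def)
  have "\<forall>\<^sub>F t in sequentially. \<forall>j\<in>{..<v}. 2 \<le> stp f (pair n j) t"
  proof (rule eventually_ball_finite)
    show "\<forall>j\<in>{..<v}. \<forall>\<^sub>F t in sequentially. 2 \<le> stp f (pair n j) t"
    proof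
      fix j assume "j \<in> {..<v}"
      with lt obtain w where "run (\<lambda>_. 2) f (pair n j) = Some (Suc w)" by blast
      from Rfind.IH[OF this] show "\<forall>\<^sub>F t in sequentially. 2 \<le> stp f (pair n j) t"
        by eventually_elim simp
    qed
  qed simp
  with Rfind.IH[OF v] eventually_gt_at_top[of v] show ?case
    by eventually_elim (simp add: stp_Rfind_eq_Suc del: stp.simps)
qed (simp_all add: p1_def p2_def)

section \<open>Strings as numbers\<close>

definition len :: "nat \<Rightarrow> nat" where
  "len n = length (str_of_nat n)"

text \<open>In binary, \<open>n + 1\<close> is a 1 followed by the string with number
  \<open>n\<close>. This explains the formula for concatenation and the bounds on \<open>len\<close>
  by powers of two.\<close>

definition app :: "nat \<Rightarrow> nat \<Rightarrow> nat" where
  "app a b = a * 2 ^ len b + b"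

lemma nat_of_str_append: "nat_of_str (x @ y) = nat_of_str x * 2 ^ length y + nat_of_str y"
  by (induction y rule: rev_induct)
    (simp_all add: nat_of_str_snoc flip: append_assoc)

lemma nat_of_str_bounds: "2 ^ length x \<le> nat_of_str x + 1 \<and> nat_of_str x + 1 < 2 ^ (length x + 1)"
  by (induction x rule: rev_induct) (auto simp: nat_of_str_snoc)

lemma len_bounds: "2 ^ len n \<le> n + 1" "n + 1 < 2 ^ (len n + 1)"
  using nat_of_str_bounds[of "str_of_nat n"] by (simp_all add: len_def)

lemma le_len_iff: "k \<le> len n \<longleftrightarrow> 2 ^ k \<le> n + 1"
proof
  assume "k \<le> len n"
  then have "(2::nat) ^ k \<le> 2 ^ len n" by (intro power_increasing) auto
  with len_bounds(1)[of n] show "2 ^ k \<le> n + 1" by linarith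
next
  assume *: "2 ^ k \<le> n + 1"
  show "k \<le> len n"
  proof (rule ccontr)
    assume "\<not> k \<le> len n"
    then have "(2::nat) ^ (len n + 1) \<le> 2 ^ k" by (intro power_increasing) auto
    with * len_bounds(2)[of n] show False by linarith
  qed
qed

lemma len_unique: "2 ^ k \<le> n + 1 \<Longrightarrow> n + 1 < 2 ^ (k + 1) \<Longrightarrow> len n = k"
  by (metis Suc_eq_plus1 le_len_iff not_less not_less_eq_eq order.antisym)

lemma len_le: "len n \<le> n"
  using len_bounds(1)[of n] less_exp[of "len n"] by linarith

lemma len_nat_of_str [simp]: "len (nat_of_str x) = length x"
  by (simp add: len_def)

lemma app_nat_of_str: "nat_of_str (x @ y) = app (nat_of_str x) (nat_of_str y)"
  by (simp add: app_def nat_of_str_append)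

lemma tc_len [tc_intros]: "tc f \<Longrightarrow> tc (\<lambda>\<phi> n. len (f \<phi> n))"
proof -
  assume f: "tc f"
  have "(\<Sum>k<n. of_bool (2 ^ (k + 1) \<le> n + 1)) = len n" for n
  proof -
    have *: "2 * 2 ^ x \<le> Suc n \<longleftrightarrow> x < len n" for x
      using le_len_iff[of "Suc x" n] by (simp add: Suc_le_eq)
    have "{..<n} \<inter> {k. 2 ^ (k + 1) \<le> n + 1} = {..<len n}"
      using len_le[of n] by (auto simp: *)
    then show ?thesis by (simp add: of_bool_def sum.If_cases)
  qed
  then have *: "len n = (\<Sum>k<n. of_bool (2 ^ (k + 1) \<le> n + 1))" for n by simp
  show ?thesis unfolding * by (intro tc_intros f tc_comp[OF f])
qed

lemma tc_app [tc_intros]: "tc f \<Longrightarrow> tc g \<Longrightarrow> tc (\<lambda>\<phi> n. app (f \<phi> n) (g \<phi> n))"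
  unfolding app_def by (intro tc_intros)

section \<open>Kraft-Chaitin theorem\<close>

text \<open>Induction on a bound for the lengths: if the empty string belongs to \<open>G\<close>,
  it is alone; otherwise the first bit splits \<open>G\<close> into two prefix-free sets of shorter
  strings, each counted with factor 1/2.\<close>

lemma kraft_inequality:
  assumes "finite G" "prefix_free G"
  shows "(\<Sum>x\<in>G. (1/2 :: real) ^ length x) \<le> 1"
proof -
  have "G \<subseteq> {x. length x \<le> n} \<Longrightarrow> (\<Sum>x\<in>G. (1/2 :: real) ^ length x) \<le> 1" for n
    using assms
  proof (induction n arbitrary: G)
    case 0
    then have "G = {} \<or> G = {[]}" by auto
    then show ?case by auto
  next
    case (Suc n)
    show ?case
    proof (cases "[] \<in> G")
      case True
      then have "G = {[]}" using Suc.prems(3) unfolding prefix_free_def by (metis Nil_prefix is_singletonI' is_singleton_the_elem singletonD empty_iff)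
      then show ?thesis by simp
    next
      case False
      define B where "B b = {x. b # x \<in> G}" for b
      have G: "G = Cons True ` B True \<union> Cons False ` B False"
        using False unfolding B_def
        by (auto simp: image_iff) (metis list.exhaust)
      have fin: "finite (B b)" for b
        unfolding B_def using finite_vimageI[OF Suc.prems(2), of "Cons b"] by (simp add: vimage_def)
      have le: "(\<Sum>x\<in>B b. (1/2 :: real) ^ length x) \<le> 1" for b
      proof (rule Suc.IH[OF _ fin])
        show "B b \<subseteq> {x. length x \<le> n}" using Suc.prems(1) by (auto simp: B_def)
        show "prefix_free (B b)" using Suc.prems(3) unfolding prefix_free_def B_def by force
      qed
      have "(\<Sum>x\<in>G. (1/2 :: real) ^ length x) =
          (\<Sum>x\<in>B True. (1/2) ^ length x) / 2 + (\<Sum>x\<in>B False. (1/2) ^ length x) / 2"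
        unfolding G using fin
        by (subst sum.union_disjoint) (auto simp: sum.reindex sum_divide_distrib)
      with le[of True] le[of False] show ?thesis by simp
    qed
  qed
  moreover have "G \<subseteq> {x. length x \<le> Max (length ` G)}" using assms(1) by auto
  ultimately show ?thesis by blast
qed

section \<open>The universal machine, its simulation in stages, and the coding theorem for
  requests\<close>

locale universal_machine =
  fixes U :: machine
  assumes univ: "universal U"
begin

definition cU :: prog where
  "cU = (SOME c. \<forall>\<alpha> p. map_option nat_of_str (U \<alpha> p) = run (tape \<alpha>) c (nat_of_str p))"

definition st :: "nat \<Rightarrow> nat \<Rightarrow> nat" where
  "st = stp cU"

definition halts :: "nat \<Rightarrow> bool" where
  "halts p \<longleftrightarrow> U (Str []) (str_of_nat p) \<noteq> None"

lemma prefix_free_dom: "prefix_free (dom (U \<alpha>))"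
  using univ by (simp add: universal_def prefix_free_machine_def)

lemma halts_prefix:
  assumes "halts a" "halts b" "prefix (str_of_nat a) (str_of_nat b)"
  shows "a = b"
proof -
  have "str_of_nat a = str_of_nat b"
    using prefix_free_dom[of "Str []"] assms unfolding halts_def prefix_free_def by (simp add: domIff)
  then show ?thesis by (metis str_of_nat_inverse)
qed

lemma run_cU: "map_option nat_of_str (U (Str []) p) = run (\<lambda>_. 2) cU (nat_of_str p)"
proof -
  have "\<exists>c. \<forall>\<alpha> p. map_option nat_of_str (U \<alpha> p) = run (tape \<alpha>) c (nat_of_str p)"
    using univ by (simp add: universal_def prefix_free_machine_def computable_def)
  then have "\<forall>\<alpha> p. map_option nat_of_str (U \<alpha> p) = run (tape \<alpha>) cU (nat_of_str p)"
    unfolding cU_def by (rule someI_ex)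
  moreover have "tape (Str []) = (\<lambda>_. 2)" by auto
  ultimately show ?thesis by metis
qed

lemma tc_st [tc_intros]: "tc f \<Longrightarrow> tc g \<Longrightarrow> tc (\<lambda>\<phi> n. st (f \<phi> n) (g \<phi> n))"
  unfolding st_def by (rule tc_stp)

lemma st_mono: "st p t = Suc v \<Longrightarrow> t \<le> t' \<Longrightarrow> st p t' = Suc v"
  unfolding st_def by (rule stp_mono)

lemma st_sound: "st p t = Suc v \<Longrightarrow> U (Str []) (str_of_nat p) = Some (str_of_nat v)"
proof -
  assume "st p t = Suc v"
  then have "map_option nat_of_str (U (Str []) (str_of_nat p)) = Some v"
    unfolding run_cU st_def by (simp add: stp_sound)
  then show ?thesis by auto
qed

lemma st_unique: "st p t = Suc v \<Longrightarrow> st p t' = Suc v' \<Longrightarrow> v = v'"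
  by (metis st_mono nat_le_linear nat.inject)

lemma st_complete: "U (Str []) (str_of_nat p) = Some x \<Longrightarrow> \<exists>t. st p t = Suc (nat_of_str x)"
  using eventually_stp[of cU p "nat_of_str x"] run_cU[of "str_of_nat p"]
    eventually_happens'[OF sequentially_bot]
  unfolding st_def by fastforce

lemma halts_iff: "halts p \<longleftrightarrow> (\<exists>t. st p t \<noteq> 0)"
  unfolding halts_def by (metis st_sound st_complete not0_implies_Suc nat.distinct(1) option.distinct(1) option.exhaust)

lemma kraft_halts:
  assumes "finite F" "\<And>p. p \<in> F \<Longrightarrow> halts p"
  shows "(\<Sum>p\<in>F. (1/2 :: real) ^ len p) \<le> 1"
proof -
  have inj: "inj_on str_of_nat F" by (metis inj_on_inverseI str_of_nat_inverse)
  have "prefix_free (str_of_nat ` F)"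
    using halts_prefix assms(2) unfolding prefix_free_def by blast
  from kraft_inequality[OF _ this] assms(1) show ?thesis
    by (simp add: sum.reindex[OF inj] len_def)
qed

lemma Kc_le: "U \<alpha> p = Some x \<Longrightarrow> Kc U x \<alpha> \<le> length p"
  unfolding Kc_def by (rule cInf_lower) auto

definition wt :: "nat \<Rightarrow> real" where
  "wt v = (if v = 0 then 0 else (1/2) ^ p1 (v - 1))"

lemma wt_nonneg: "0 \<le> wt v"
  by (simp add: wt_def)

text \<open>The value \<open>Suc (pair k x)\<close> of \<open>r\<close> requests a program of length \<open>k\<close> for \<open>x\<close>, and 0 requests
  nothing. The parameter \<open>u\<close> is passed by a program \<open>q\<close> for it, so its cost is \<open>len q\<close>, and the
  weights are summed for a fixed parameter only.\<close>

definition program_bound :: "((nat \<Rightarrow> nat) \<Rightarrow> nat \<Rightarrow> nat \<Rightarrow> nat) \<Rightarrow> nat \<Rightarrow> bool" where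
  "program_bound r c \<longleftrightarrow> (\<forall>\<alpha> q t u j k x. st q t = Suc u \<longrightarrow>
      (\<forall>J. (\<Sum>j<J. wt (r (tape \<alpha>) (pair q u) j)) \<le> 1) \<longrightarrow>
      r (tape \<alpha>) (pair q u) j = Suc (pair k x) \<longrightarrow>
      (\<exists>p. U \<alpha> p = Some (str_of_nat x) \<and> length p \<le> len q + k + c))"

text \<open>The requests are served in order by consecutive intervals; half of each interval
  is lost to rounding to a dyadic one.\<close>

lemma kraft_chaitin:
  assumes r: "tc (\<lambda>\<phi> e. r \<phi> (p1 e) (p2 e))"
  shows "\<exists>c. program_bound r c"
proof -
  note tcr = tc_comp2[OF r]
  \<comment> \<open>The weight \<open>S\<close> of the requests before \<open>j\<close> is
    \<open>N / 2 ^ M\<close>: the sum \<open>M\<close> of their lengths is a computable exponent for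
    a common denominator.\<close>
  define M where "M \<phi> v j = (\<Sum>l<j. p1 (r \<phi> v l - 1))" for \<phi> v j
  define N :: "(nat \<Rightarrow> nat) \<Rightarrow> nat \<Rightarrow> nat \<Rightarrow> nat" where
    "N \<phi> v j = (\<Sum>l<j. if r \<phi> v l = 0 then 0 else 2 ^ (M \<phi> v j - p1 (r \<phi> v l - 1)))" for \<phi> v j
  define k where "k \<phi> v j = p1 (r \<phi> v j - 1)" for \<phi> v j
  \<comment> \<open>\<open>A\<close> is \<open>S * 2 ^ (k + 1)\<close> rounded up, so the dyadic
    interval of length 2^-(k+1) starting at \<open>A / 2 ^ (k + 1)\<close> fits into the interval of
    length 2^-k starting at \<open>S\<close>. The additional digit is the \<open>+ 1\<close> in the
    final constant.\<close>
  define A where "A \<phi> v j = (N \<phi> v j * 2 ^ (k \<phi> v j + 1) + 2 ^ M \<phi> v j - 1) div 2 ^ M \<phi> v j" for \<phi> v j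
  define S where "S \<phi> v j = (\<Sum>l<j. wt (r \<phi> v l))" for \<phi> v j
  have S: "S \<phi> v j = real (N \<phi> v j) / 2 ^ M \<phi> v j" for \<phi> v j
  proof -
    have "real (if r \<phi> v l = 0 then 0 else 2 ^ (M \<phi> v j - p1 (r \<phi> v l - 1))) = wt (r \<phi> v l) * 2 ^ M \<phi> v j"
      if "l < j" for l
    proof -
      have "p1 (r \<phi> v l - 1) \<le> M \<phi> v j" unfolding M_def
        by (rule member_le_sum[where f = "\<lambda>l. p1 (r \<phi> v l - 1)"]) (use that in auto)
      then have "(2::real) ^ (M \<phi> v j - p1 (r \<phi> v l - 1)) = 2 ^ M \<phi> v j / 2 ^ p1 (r \<phi> v l - 1)"
        by (simp add: power_diff)
      then show ?thesis by (simp add: wt_def power_one_over)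
    qed
    then have "real (N \<phi> v j) = S \<phi> v j * 2 ^ M \<phi> v j"
      unfolding N_def S_def of_nat_sum sum_distrib_right by (intro sum.cong) auto
    then show ?thesis by simp
  qed
  have A: "S \<phi> v j \<le> A \<phi> v j / 2 ^ (k \<phi> v j + 1)" "(real (A \<phi> v j) + 1) / 2 ^ (k \<phi> v j + 1) < S \<phi> v j + 1 / 2 ^ k \<phi> v j" for \<phi> v j
  proof -
    define n m where "n = N \<phi> v j * 2 ^ (k \<phi> v j + 1)" and "m = (2::nat) ^ M \<phi> v j"
    have a: "A \<phi> v j = (n + m - 1) div m" by (simp add: A_def n_def m_def)
    have m: "m > 0" by (simp add: m_def)
    have e: "(n + m - 1) div m * m + (n + m - 1) mod m = n + m - 1" by simp
    have "(n + m - 1) mod m < m" using m by simp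
    with e m have "n \<le> A \<phi> v j * m" "A \<phi> v j * m < n + m" unfolding a by linarith+
    then have "real n \<le> real (A \<phi> v j) * real m" "real (A \<phi> v j) * real m < real n + real m"
      by (metis of_nat_le_iff of_nat_mult, metis of_nat_less_iff of_nat_mult of_nat_add)
    then have *: "real n / real m \<le> A \<phi> v j" "A \<phi> v j < real n / real m + 1"
      using m by (simp_all add: field_simps)
    have "real n / real m = S \<phi> v j * 2 ^ (k \<phi> v j + 1)"
      by (simp add: n_def m_def S)
    with * have "S \<phi> v j * 2 ^ (k \<phi> v j + 1) \<le> A \<phi> v j" "A \<phi> v j + 1 < S \<phi> v j * 2 ^ (k \<phi> v j + 1) + 2"
      by linarith+
    moreover have "(S \<phi> v j + 1 / 2 ^ k \<phi> v j) * 2 ^ (k \<phi> v j + 1) = S \<phi> v j * 2 ^ (k \<phi> v j + 1) + 2"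
      by (simp add: distrib_right)
    ultimately show "S \<phi> v j \<le> A \<phi> v j / 2 ^ (k \<phi> v j + 1)"
      "(real (A \<phi> v j) + 1) / 2 ^ (k \<phi> v j + 1) < S \<phi> v j + 1 / 2 ^ k \<phi> v j"
      by (simp_all only: pos_divide_less_eq pos_le_divide_eq zero_less_power zero_less_numeral)
  qed
  have S_mono: "i \<le> j \<Longrightarrow> S \<phi> v i \<le> S \<phi> v j" for i j \<phi> v
    unfolding S_def by (rule sum_mono2) (auto simp: wt_nonneg)
  have S_Suc: "S \<phi> v (Suc j) = S \<phi> v j + 1 / 2 ^ k \<phi> v j" if "r \<phi> v j \<noteq> 0" for j \<phi> v
    using that by (simp add: S_def wt_def k_def power_one_over)
  \<comment> \<open>A program \<open>w\<close> consists of a halting program \<open>a\<close> for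
    the parameter and the \<open>k + 1\<close> binary digits of \<open>A\<close> as a string with
    number \<open>b\<close>; the leading 1 of \<open>b + 1\<close> gives the equation. The search
    witness packs \<open>a\<close>, \<open>b\<close>, the stage \<open>t\<close> and the index
    \<open>j\<close>.\<close>
  define valid where "valid \<phi> w a b t j \<longleftrightarrow> (let v = pair a (st a t - 1) in
      w = app a b \<and> st a t \<noteq> 0 \<and> r \<phi> v j \<noteq> 0 \<and> b + 1 = 2 ^ (k \<phi> v j + 1) + A \<phi> v j \<and>
      A \<phi> v j < 2 ^ (k \<phi> v j + 1))" for \<phi> w a b t j
  define P where "P \<phi> w z = valid \<phi> w (p1 z) (p1 (p2 z)) (p1 (p2 (p2 z))) (p2 (p2 (p2 z)))" for \<phi> w z
  define g where "g \<phi> w z = p2 (r \<phi> (pair (p1 z) (st (p1 z) (p1 (p2 (p2 z))) - 1)) (p2 (p2 (p2 z))) - 1)"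
    for \<phi> :: "nat \<Rightarrow> nat" and w z :: nat
  \<comment> \<open>Comparable words have comparable halting parts, so \<open>a' = a\<close>.
    Comparable digit strings then mean nested dyadic intervals, whereas distinct requests have
    disjoint ones. This gives prefix-freeness and also shows that the output does not depend on the
    witness found first.\<close>
  have key: "w = w' \<and> r \<phi> (pair a (st a t - 1)) j = r \<phi> (pair a' (st a' t' - 1)) j'"
    if pre: "prefix (str_of_nat w) (str_of_nat w')"
      and val: "valid \<phi> w a b t j" "valid \<phi> w' a' b' t' j'" for \<phi> w w' a b t j a' b' t' j'
  proof -
    have w: "str_of_nat w = str_of_nat a @ str_of_nat b" "str_of_nat w' = str_of_nat a' @ str_of_nat b'"
      using val by (simp_all add: valid_def Let_def) (metis app_nat_of_str nat_of_str_inverse str_of_nat_inverse)+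
    have "halts a" "halts a'" using val by (auto simp: valid_def Let_def halts_iff)
    moreover have "prefix (str_of_nat a) (str_of_nat a') \<or> prefix (str_of_nat a') (str_of_nat a)"
      using pre w by (metis prefix_same_cases prefix_order.trans prefixI)
    ultimately have aa: "a' = a" using halts_prefix by blast
    have "st a t \<noteq> 0" "st a t' \<noteq> 0" using val aa by (auto simp: valid_def Let_def)
    then have ss: "st a t' - 1 = st a t - 1" by (metis st_unique diff_Suc_1 not0_implies_Suc)
    define v where "v = pair a (st a t - 1)"
    have v: "r \<phi> v j \<noteq> 0" "b + 1 = 2 ^ (k \<phi> v j + 1) + A \<phi> v j" "A \<phi> v j < 2 ^ (k \<phi> v j + 1)"
      "r \<phi> v j' \<noteq> 0" "b' + 1 = 2 ^ (k \<phi> v j' + 1) + A \<phi> v j'" "A \<phi> v j' < 2 ^ (k \<phi> v j' + 1)"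
      using val unfolding valid_def Let_def aa ss v_def by blast+
    have lb: "len b = k \<phi> v j + 1" "len b' = k \<phi> v j' + 1"
      by (rule len_unique; use v in simp)+
    obtain s where s: "str_of_nat b' = str_of_nat b @ s"
      using pre w aa by (auto simp: prefix_def)
    define l where "l = length s"
    have kk: "k \<phi> v j' = k \<phi> v j + l" using lb arg_cong[OF s, of length] by (simp add: len_def l_def)
    have "b' = b * 2 ^ l + nat_of_str s"
      using arg_cong[OF s, of nat_of_str] by (simp add: nat_of_str_append l_def)
    moreover have "2 ^ l \<le> nat_of_str s + 1" "nat_of_str s + 1 < 2 ^ (l + 1)"
      using nat_of_str_bounds[of s] by (simp_all add: l_def)
    moreover have "(b + 1) * 2 ^ l = 2 ^ (k \<phi> v j' + 1) + A \<phi> v j * 2 ^ l"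
      unfolding v(2) kk by (simp add: power_add algebra_simps)
    ultimately have "A \<phi> v j * 2 ^ l \<le> A \<phi> v j'" "A \<phi> v j' < A \<phi> v j * 2 ^ l + 2 ^ l"
      using v(5) by (simp_all add: algebra_simps)
    then have "real (A \<phi> v j * 2 ^ l) \<le> A \<phi> v j'" "A \<phi> v j' < real (A \<phi> v j * 2 ^ l + 2 ^ l)"
      by (simp_all only: of_nat_le_iff of_nat_less_iff)
    then have "real (A \<phi> v j) * 2 ^ l \<le> A \<phi> v j'" "A \<phi> v j' < (real (A \<phi> v j) + 1) * 2 ^ l"
      by (simp_all add: distrib_right)
    moreover have "x / 2 ^ (k \<phi> v j + 1) = x * 2 ^ l / 2 ^ (k \<phi> v j' + 1)" for x :: real
      by (simp add: kk power_add)
    ultimately have nest: "A \<phi> v j / 2 ^ (k \<phi> v j + 1) \<le> A \<phi> v j' / 2 ^ (k \<phi> v j' + 1)"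
      "A \<phi> v j' / 2 ^ (k \<phi> v j' + 1) < (real (A \<phi> v j) + 1) / 2 ^ (k \<phi> v j + 1)"
      by (simp_all only: divide_right_mono divide_strict_right_mono zero_le_power zero_less_power
          zero_le_numeral zero_less_numeral)
    have "\<not> j < j'"
    proof
      assume "j < j'"
      then have "S \<phi> v (Suc j) \<le> S \<phi> v j'" by (intro S_mono) simp
      then show False using S_Suc[OF v(1)] A[of \<phi> v j] A[of \<phi> v j'] nest by linarith
    qed
    moreover have "\<not> j' < j"
    proof
      assume "j' < j"
      then have "S \<phi> v (Suc j') \<le> S \<phi> v j" by (intro S_mono) simp
      moreover have "A \<phi> v j' / 2 ^ (k \<phi> v j' + 1) \<le> (real (A \<phi> v j') + 1) / 2 ^ (k \<phi> v j' + 1)"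
        by (simp add: divide_right_mono)
      ultimately show False using S_Suc[OF v(4)] A[of \<phi> v j] A[of \<phi> v j'] nest by linarith
    qed
    ultimately have jj: "j' = j" by simp
    then have "s = []" using kk by (simp add: l_def)
    then have "w = w'" using w s aa by (metis append_Nil2 str_of_nat_inverse)
    then show ?thesis unfolding aa ss jj by blast
  qed
  define T :: machine where "T \<alpha> p = (if \<exists>z. P (tape \<alpha>) (nat_of_str p) z
     then Some (str_of_nat (g (tape \<alpha>) (nat_of_str p) (LEAST z. P (tape \<alpha>) (nat_of_str p) z))) else None)" for \<alpha> p
  have tcM: "tc (\<lambda>\<phi> n. M \<phi> (x \<phi> n) (y \<phi> n))" if "tc x" "tc y" for x y
    by (rule tc_comp2[OF _ that]) (unfold M_def, intro tc_intros tcr)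
  have tcN: "tc (\<lambda>\<phi> n. N \<phi> (x \<phi> n) (y \<phi> n))" if "tc x" "tc y" for x y
    by (rule tc_comp2[OF _ that]) (unfold N_def, intro tc_intros tcr tcM)
  have tck: "tc (\<lambda>\<phi> n. k \<phi> (x \<phi> n) (y \<phi> n))" if "tc x" "tc y" for x y
    unfolding k_def by (intro tc_intros tcr that)
  have tcA: "tc (\<lambda>\<phi> n. A \<phi> (x \<phi> n) (y \<phi> n))" if "tc x" "tc y" for x y
    by (rule tc_comp2[OF _ that]) (unfold A_def, intro tc_intros tck tcN tcM)
  have "computable T"
  proof (rule computable_search)
    show "dec (\<lambda>\<phi> e. P \<phi> (p1 e) (p2 e))"
      unfolding P_def valid_def Let_def by (intro tc_intros tcr tck tcA)
    show "tc (\<lambda>\<phi> e. g \<phi> (p1 e) (p2 e))"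
      unfolding g_def by (intro tc_intros tcr)
  qed (simp add: T_def)
  moreover have "prefix_free (dom (T \<alpha>))" for \<alpha>
    unfolding prefix_free_def
  proof (intro ballI impI)
    fix x y assume "x \<in> dom (T \<alpha>)" "y \<in> dom (T \<alpha>)" and pre: "prefix x y"
    then obtain z z' where "P (tape \<alpha>) (nat_of_str x) z" "P (tape \<alpha>) (nat_of_str y) z'"
      unfolding T_def dom_def by (auto split: if_splits)
    from key[OF _ this[unfolded P_def]] pre have "nat_of_str x = nat_of_str y" by simp
    then show "x = y" by (metis nat_of_str_inverse)
  qed
  ultimately have "prefix_free_machine T" by (simp add: prefix_free_machine_def)
  then obtain c where c: "\<And>\<alpha> p x. T \<alpha> p = Some x \<Longrightarrow> \<exists>q. U \<alpha> q = Some x \<and> length q \<le> length p + c"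
    using univ unfolding universal_def by blast
  have "\<exists>p. U \<alpha> p = Some (str_of_nat x) \<and> length p \<le> len q + kk + (c + 1)"
    if q: "st q t = Suc u" and sum: "\<forall>J. (\<Sum>j<J. wt (r (tape \<alpha>) (pair q u) j)) \<le> 1"
      and rj: "r (tape \<alpha>) (pair q u) j = Suc (pair kk x)" for \<alpha> q t u j kk x
  proof -
    define v \<phi> where "v = pair q u" and "\<phi> = tape \<alpha>"
    have kv: "k \<phi> v j = kk" using rj by (simp add: k_def v_def \<phi>_def)
    have rv: "r \<phi> v j \<noteq> 0" using rj by (simp add: v_def \<phi>_def)
    have "S \<phi> v (Suc j) \<le> 1" using sum[rule_format, of "Suc j"] by (simp add: S_def v_def \<phi>_def)
    with A(2)[of \<phi> v j] S_Suc[OF rv] have "(real (A \<phi> v j) + 1) / 2 ^ (kk + 1) < 1"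
      unfolding kv by linarith
    then have "real (A \<phi> v j) + 1 < 1 * 2 ^ (kk + 1)"
      by (simp only: pos_divide_less_eq zero_less_power zero_less_numeral)
    then have "real (A \<phi> v j + 1) < real (2 ^ (kk + 1))" by simp
    then have Alt: "A \<phi> v j + 1 < 2 ^ (kk + 1)" by (simp only: of_nat_less_iff)
    define b where "b = 2 ^ (kk + 1) + A \<phi> v j - 1"
    have b: "b + 1 = 2 ^ (kk + 1) + A \<phi> v j" by (simp add: b_def)
    have lb: "len b = kk + 1" by (rule len_unique; use b Alt in simp)
    define w where "w = str_of_nat q @ str_of_nat b"
    have nw: "nat_of_str w = app q b" by (simp add: w_def app_nat_of_str)
    define z where "z = pair q (pair b (pair t j))"
    have Pz: "P \<phi> (nat_of_str w) z"
      using q rv b Alt by (simp add: P_def z_def valid_def Let_def nw kv flip: v_def)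
    define z0 where "z0 = (LEAST z. P \<phi> (nat_of_str w) z)"
    have Pz0: "P \<phi> (nat_of_str w) z0" unfolding z0_def using Pz by (rule LeastI)
    from key[OF _ Pz[unfolded P_def] Pz0[unfolded P_def]]
    have "g \<phi> (nat_of_str w) z0 = g \<phi> (nat_of_str w) z" by (simp add: g_def)
    also have "\<dots> = x" using rj q by (simp add: g_def z_def \<phi>_def)
    finally have "T \<alpha> w = Some (str_of_nat x)"
      using Pz unfolding T_def z0_def \<phi>_def by auto
    from c[OF this] obtain p where "U \<alpha> p = Some (str_of_nat x)" "length p \<le> length w + c"
      by blast
    moreover have "length w = len q + (kk + 1)" using lb by (simp add: w_def len_def)
    ultimately show ?thesis by (intro exI[of _ p]) simp
  qed
  then show ?thesis unfolding program_bound_def by blast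
qed

lemma sum_wt:
  fixes J :: nat
  shows "(\<Sum>j<J. wt (if Q j then Suc (pair (k j) (x j)) else 0)) = (\<Sum>j\<in>{j. j < J \<and> Q j}. (1/2) ^ k j)"
proof -
  have "(\<Sum>j<J. wt (if Q j then Suc (pair (k j) (x j)) else 0)) =
      (\<Sum>j<J. if Q j then (1/2) ^ k j else 0)"
    by (intro sum.cong) (simp_all add: wt_def)
  also have "\<dots> = (\<Sum>j\<in>{j. j < J \<and> Q j}. (1/2) ^ k j)"
    using sum.inter_filter[OF finite_lessThan[of J], of "\<lambda>j. (1/2 :: real) ^ k j" Q] by simp
  finally show ?thesis .
qed

section \<open>General bounds on complexity\<close>

abbreviation kn :: "nat \<Rightarrow> nat" where
  "kn x \<equiv> K U (str_of_nat x)"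

lemma st_halts: "st p t = Suc v \<Longrightarrow> halts p"
  unfolding halts_iff by (metis nat.distinct(1))

text \<open>Supplies a fixed parameter program, whose length is a constant, for the unconditional
  bound that follows.\<close>

lemma exists_halts: "\<exists>q t u. st q t = Suc u"
proof -
  define T :: machine where "T \<alpha> p = (if p = [] then Some [] else None)" for \<alpha> p
  have "computable T"
  proof (rule computable_search[where P = "\<lambda>\<phi> w z. w = 0" and g = "\<lambda>\<phi> w z. 0"])
    show "dec (\<lambda>\<phi> e. p1 e = 0)" "tc (\<lambda>\<phi> e. 0)" by (intro tc_intros)+
  qed (simp add: T_def)
  then have "prefix_free_machine T"
    by (auto simp: prefix_free_machine_def prefix_free_def T_def dom_def split: if_splits)
  then obtain c where "\<forall>\<alpha> p x. T \<alpha> p = Some x \<longrightarrow> (\<exists>q. U \<alpha> q = Some x \<and> length q \<le> length p + c)"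
    using univ unfolding universal_def by blast
  moreover have "T (Str []) [] = Some []" by (simp add: T_def)
  ultimately obtain q where "U (Str []) q = Some []" by blast
  then show ?thesis using st_complete[of "nat_of_str q"] by auto
qed

lemma program_le_len:
  "\<exists>c. \<forall>x. \<exists>p. U (Str []) p = Some (str_of_nat x) \<and> length p \<le> 2 * len x + c"
proof -
  define r :: "(nat \<Rightarrow> nat) \<Rightarrow> nat \<Rightarrow> nat \<Rightarrow> nat"
    where "r \<phi> v j = (if True then Suc (pair (2 * len j + 2) j) else 0)" for \<phi> v j
  have tcr: "tc (\<lambda>\<phi> e. r \<phi> (p1 e) (p2 e))" unfolding r_def if_True by (intro tc_intros)
  from kraft_chaitin[where r = r, OF tcr] obtain c where c: "program_bound r c" ..
  \<comment> \<open>Since \<open>j + 2 \<le> 2 ^ (len j + 1)\<close>, request \<open>j\<close>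
    weighs at most 1/((j+1)(j+2)), and these bounds telescope.\<close>
  have "(\<Sum>j<J. wt (r \<phi> v j)) \<le> 1 - 1 / (J + 1)" for \<phi> v J
  proof (induction J)
    case (Suc J)
    have "J + 2 \<le> 2 ^ (len J + 1)" "J + 1 \<le> 2 ^ (len J + 1)" using len_bounds(2)[of J] by linarith+
    then have "(J + 1) * (J + 2) \<le> 2 ^ (len J + 1) * 2 ^ (len J + 1)" by (intro mult_le_mono)
    also have "\<dots> = 2 ^ (2 * len J + 2)" by (simp flip: power_add)
    finally have "real ((J + 1) * (J + 2)) \<le> real (2 ^ (2 * len J + 2))" by (simp only: of_nat_le_iff)
    then have "1 / real (2 ^ (2 * len J + 2)) \<le> 1 / real ((J + 1) * (J + 2))"
      by (intro frac_le) (simp_all only: of_nat_0_less_iff, simp_all)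
    moreover have "wt (r \<phi> v J) = 1 / real (2 ^ (2 * len J + 2))"
      by (simp add: wt_def r_def power_one_over)
    moreover have "real ((J + 1) * (J + 2)) = (real J + 1) * (real J + 2)"
      by (simp only: of_nat_mult of_nat_add of_nat_1 of_nat_numeral)
    ultimately have "wt (r \<phi> v J) \<le> 1 / ((real J + 1) * (real J + 2))" by simp
    also have "\<dots> = 1 / (real J + 1) - 1 / (real J + 2)" by (simp add: divide_simps)
    finally show ?case using Suc by (simp add: add.commute)
  qed simp
  moreover have "1 - 1 / (real J + 1) \<le> 1" for J :: nat by simp
  ultimately have sum: "(\<Sum>j<J. wt (r \<phi> v j)) \<le> 1" for \<phi> v J by (meson order.trans)
  obtain q t u where "st q t = Suc u" using exists_halts by blast
  moreover have "r (tape (Str [])) (pair q u) x = Suc (pair (2 * len x + 2) x)" for x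
    by (simp add: r_def)
  ultimately have "\<exists>p. U (Str []) p = Some (str_of_nat x) \<and>
      length p \<le> len q + (2 * len x + 2) + c" for x
    using c sum unfolding program_bound_def by blast
  then show ?thesis by (intro exI[of _ "len q + 2 + c"]) (simp add: algebra_simps)
qed

lemma K_le_len: "\<exists>c. \<forall>x. kn x \<le> 2 * len x + c"
proof -
  obtain c where c: "\<forall>x. \<exists>p. U (Str []) p = Some (str_of_nat x) \<and> length p \<le> 2 * len x + c"
    using program_le_len ..
  have "kn x \<le> 2 * len x + c" for x
  proof -
    obtain p where "U (Str []) p = Some (str_of_nat x)" "length p \<le> 2 * len x + c" using c by blast
    then show ?thesis unfolding K_def using Kc_le order.trans by blast
  qed
  then show ?thesis by blast
qed

lemma K_attained:
  obtains q t where "st q t = Suc x" "len q = kn x"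
proof -
  have "{length p | p. U (Str []) p = Some (str_of_nat x)} \<noteq> {}"
    using program_le_len by blast
  from Inf_nat_def1[OF this] obtain p where p: "U (Str []) p = Some (str_of_nat x)" "length p = kn x"
    unfolding K_def Kc_def by auto
  then obtain t where "st (nat_of_str p) t = Suc x"
    using st_complete[of "nat_of_str p" "str_of_nat x"] by auto
  then show thesis using that p(2) by simp
qed

text \<open>The empty program, if it halts, is a prefix of all other halting programs, but a second
  output needs a second program. In the final estimate this lets K(i) absorb additive constants even
  when \<open>log_plus\<close> vanishes.\<close>

lemma K_pos: "1 \<le> kn x"
proof (rule ccontr)
  assume "\<not> 1 \<le> kn x"
  moreover obtain q t where q: "st q t = Suc x" "len q = kn x" by (rule K_attained)
  ultimately have "len q = 0" by simp
  obtain q' t' where q': "st q' t' = Suc (Suc x)" using K_attained by metis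
  have "str_of_nat q = []" using \<open>len q = 0\<close> by (simp add: len_def)
  then have "q = q'" using q(1) q' by (intro halts_prefix) (auto dest: st_halts)
  with q' have "st q t' = Suc (Suc x)" by simp
  from st_unique[OF q(1) this] show False by simp
qed

text \<open>The case of \<open>program_bound\<close> in which requests depend on \<open>u\<close>
  alone; the parameter program can then be taken shortest and costs \<open>kn u\<close>.\<close>

definition K_bound :: "((nat \<Rightarrow> nat) \<Rightarrow> nat \<Rightarrow> nat \<Rightarrow> nat) \<Rightarrow> nat \<Rightarrow> bool" where
  "K_bound r c \<longleftrightarrow> (\<forall>\<alpha> u j k x. (\<forall>J. (\<Sum>j<J. wt (r (tape \<alpha>) u j)) \<le> 1) \<longrightarrow>
      r (tape \<alpha>) u j = Suc (pair k x) \<longrightarrow> Kc U (str_of_nat x) \<alpha> \<le> kn u + k + c)"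

lemma K_boundD:
  "K_bound r c \<Longrightarrow> (\<And>J. (\<Sum>j<J. wt (r (tape \<alpha>) u j)) \<le> 1) \<Longrightarrow>
    r (tape \<alpha>) u j = Suc (pair k x) \<Longrightarrow> Kc U (str_of_nat x) \<alpha> \<le> kn u + k + c"
  unfolding K_bound_def by blast

lemma K_le_request:
  assumes "tc (\<lambda>\<phi> e. r \<phi> (p1 e) (p2 e))"
  shows "\<exists>c. K_bound r c"
proof -
  have "tc (\<lambda>\<phi> e. r \<phi> (p2 (p1 e)) (p2 e))" by (intro tc_comp2[OF assms] tc_intros)
  from kraft_chaitin[where r = "\<lambda>\<phi> v j. r \<phi> (p2 v) j", OF this]
  obtain c where c: "program_bound (\<lambda>\<phi> v j. r \<phi> (p2 v) j) c" ..
  have "Kc U (str_of_nat x) \<alpha> \<le> kn u + k + c"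
    if a: "\<forall>J. (\<Sum>j<J. wt (r (tape \<alpha>) u j)) \<le> 1" "r (tape \<alpha>) u j = Suc (pair k x)" for \<alpha> u j k x
  proof -
    obtain q t where q: "st q t = Suc u" "len q = kn u" using K_attained by blast
    with c a obtain p where "U \<alpha> p = Some (str_of_nat x)" "length p \<le> kn u + k + c"
      unfolding program_bound_def p2_pair by metis
    then show ?thesis using Kc_le order.trans by blast
  qed
  then show ?thesis unfolding K_bound_def by blast
qed

lemma K_pair:
  obtains c where "\<And>a b. kn (pair a b) \<le> kn a + kn b + c"
proof -
  \<comment> \<open>An index packs a program with its first halting stage, so that each program
    makes at most one request and Kraft's inequality applies.\<close>
  define Q where "Q j \<longleftrightarrow> st (p1 j) (p2 j) \<noteq> 0 \<and> (\<forall>s<p2 j. st (p1 j) s = 0)" for j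
  define r :: "(nat \<Rightarrow> nat) \<Rightarrow> nat \<Rightarrow> nat \<Rightarrow> nat" where
    "r \<phi> u j = (if Q j then Suc (pair (len (p1 j)) (pair u (st (p1 j) (p2 j) - 1))) else 0)" for \<phi> u j
  have tcr: "tc (\<lambda>\<phi> e. r \<phi> (p1 e) (p2 e))" unfolding r_def Q_def by (intro tc_intros)
  from K_le_request[where r = r, OF tcr] obtain c where c: "K_bound r c" ..
  have sum: "(\<Sum>j<J. wt (r \<phi> u j)) \<le> 1" for \<phi> u J
  proof -
    have inj: "inj_on p1 {j. j < J \<and> Q j}"
    proof (rule inj_onI)
      fix i j assume "i \<in> {j. j < J \<and> Q j}" "j \<in> {j. j < J \<and> Q j}" "p1 i = p1 j"
      moreover from this have "\<not> p2 i < p2 j" "\<not> p2 j < p2 i" unfolding Q_def by auto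
      then have "p2 i = p2 j" by simp
      ultimately show "i = j" by (metis pair_p1_p2)
    qed
    have "(\<Sum>j<J. wt (r \<phi> u j)) = (\<Sum>p\<in>p1 ` {j. j < J \<and> Q j}. (1/2) ^ len p)"
      unfolding r_def sum_wt by (simp add: sum.reindex[OF inj])
    also have "\<dots> \<le> 1" by (rule kraft_halts) (auto simp: Q_def halts_iff)
    finally show ?thesis .
  qed
  have "kn (pair a b) \<le> kn a + kn b + c" for a b
  proof -
    obtain p t where p: "st p t = Suc b" "len p = kn b" using K_attained by blast
    define t' where "t' = (LEAST t. st p t \<noteq> 0)"
    have t': "st p t' \<noteq> 0" unfolding t'_def by (rule LeastI[of _ t]) (simp add: p)
    have "\<forall>s<t'. st p s = 0" unfolding t'_def using not_less_Least by blast
    moreover have "st p t' - 1 = b" using t' p(1) by (metis st_unique diff_Suc_1 not0_implies_Suc)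
    ultimately have "r (tape (Str [])) a (pair p t') = Suc (pair (len p) (pair a b))"
      using t' by (simp add: r_def Q_def)
    from K_boundD[OF c sum this] show ?thesis by (simp add: K_def p(2))
  qed
  then show thesis by (rule that)
qed

text \<open>A diagonal argument: \<open>t\<close> and \<open>N\<close> yield a number without programs of length at most \<open>N\<close>.\<close>

lemma K_halting_time:
  obtains c where "\<And>t N. (\<And>p. halts p \<Longrightarrow> len p \<le> N \<Longrightarrow> st p t \<noteq> 0) \<Longrightarrow> N < kn (pair t N) + c"
proof -
  define out where "out u y \<longleftrightarrow> (\<exists>p<2 ^ (p2 u + 1). len p \<le> p2 u \<and> st p (p1 u) = Suc y)" for u y
  \<comment> \<open>Only the least number that is not an output is requested, so one request of
    length 0 already respects the weight bound.\<close>
  define r :: "(nat \<Rightarrow> nat) \<Rightarrow> nat \<Rightarrow> nat \<Rightarrow> nat" where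
    "r \<phi> u j = (if \<not> out u j \<and> (\<forall>i<j. out u i) then Suc (pair 0 j) else 0)" for \<phi> u j
  have tcr: "tc (\<lambda>\<phi> e. r \<phi> (p1 e) (p2 e))" unfolding r_def out_def by (intro tc_intros)
  from K_le_request[where r = r, OF tcr] obtain c where c: "K_bound r c" ..
  have sum: "(\<Sum>j<J. wt (r \<phi> u j)) \<le> 1" for \<phi> u J
  proof -
    have "card {j. j < J \<and> \<not> out u j \<and> (\<forall>i<j. out u i)} \<le> Suc 0"
      by (subst card_le_Suc0_iff_eq) (auto, metis linorder_neqE_nat)
    then show ?thesis unfolding r_def sum_wt by simp
  qed
  have "N < kn (pair t N) + (c + 1)" if halted: "\<And>p. halts p \<Longrightarrow> len p \<le> N \<Longrightarrow> st p t \<noteq> 0" for t N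
  proof -
    define u where "u = pair t N"
    have "{y. out u y} \<subseteq> (\<lambda>p. st p (p1 u) - 1) ` {..<2 ^ (p2 u + 1)}"
      by (force simp: out_def)
    then have "finite {y. out u y}" using finite_surj by blast
    then obtain z where "\<not> out u z" using ex_new_if_finite[of "{y. out u y}"] by auto
    define y where "y = (LEAST y. \<not> out u y)"
    have y: "\<not> out u y" "\<forall>i<y. out u i"
      unfolding y_def using \<open>\<not> out u z\<close> by (rule LeastI) (use not_less_Least in blast)
    then have "r (tape (Str [])) u y = Suc (pair 0 y)" by (simp add: r_def)
    from K_boundD[OF c sum this] have "kn y \<le> kn u + c" by (simp add: K_def)
    moreover have "N < kn y"
    proof (rule ccontr)
      assume "\<not> N < kn y"
      obtain p s where p: "st p s = Suc y" "len p = kn y" using K_attained by blast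
      then have le: "len p \<le> N" using \<open>\<not> N < kn y\<close> by simp
      have "st p t \<noteq> 0" using halted le st_halts[OF p(1)] by blast
      then have "st p t = Suc y" using p(1) by (metis st_unique not0_implies_Suc)
      moreover have "p < 2 ^ (N + 1)"
        using len_bounds(2)[of p] power_increasing[of "len p + 1" "N + 1" "2::nat"] le by linarith
      ultimately have "out u y" unfolding out_def u_def using le by auto
      with y show False by simp
    qed
    ultimately show ?thesis by (simp add: u_def)
  qed
  then show thesis by (rule that)
qed

end

section \<open>Encoded finite sets\<close>

text \<open>Finite sets have two codes: the bit mask \<open>s\<close>, on which membership is easily
  decided, and the number \<open>enc s\<close> of the string encoding whose complexity is
  measured.\<close>

definition enc :: "nat \<Rightarrow> nat" where
  "enc s = nat_of_str (encode_set (str_of_nat ` set_decode s))"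

lemma self_delim_append_eq:
  "self_delim x @ u = self_delim y @ v \<longleftrightarrow> x = y \<and> u = v"
proof
  assume eq: "self_delim x @ u = self_delim y @ v"
  have "takeWhile id (replicate k True @ False # w) = replicate k True" for k w
    by (induction k) simp_all
  then have "length (takeWhile id (self_delim z @ w)) = length z" for z w
    by (simp add: self_delim_def)
  with eq have "length x = length y" by metis
  with eq show "x = y \<and> u = v" by (simp add: self_delim_def)
qed simp

lemma concat_self_delim_inject:
  "length xs = length ys \<Longrightarrow>
    concat (map (\<lambda>n. self_delim (str_of_nat n)) xs) = concat (map (\<lambda>n. self_delim (str_of_nat n)) ys) \<Longrightarrow>
    xs = ys"
proof (induction xs ys rule: list_induct2)
  case (Cons x xs y ys)
  then have "str_of_nat x = str_of_nat y"
    "concat (map (\<lambda>n. self_delim (str_of_nat n)) xs) = concat (map (\<lambda>n. self_delim (str_of_nat n)) ys)"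
    by (simp_all add: self_delim_append_eq)
  with Cons.IH show ?case by (metis str_of_nat_inverse)
qed simp

lemma encode_set_inject:
  assumes "finite D" "finite D'" "encode_set D = encode_set D'"
  shows "D = D'"
proof -
  have inj: "inj nat_of_str" by (rule bij_is_inj[OF bij_nat_of_str])
  from assms(3) have "str_of_nat (card D) = str_of_nat (card D')"
    and c: "concat (map (\<lambda>n. self_delim (str_of_nat n)) (sorted_list_of_set (nat_of_str ` D))) =
        concat (map (\<lambda>n. self_delim (str_of_nat n)) (sorted_list_of_set (nat_of_str ` D')))"
    unfolding encode_set_def self_delim_append_eq by blast+
  then have "card D = card D'" by (metis str_of_nat_inverse)
  then have "length (sorted_list_of_set (nat_of_str ` D)) = length (sorted_list_of_set (nat_of_str ` D'))"
    by (simp add: card_image inj_on_subset[OF inj])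
  from concat_self_delim_inject[OF this c]
  have "nat_of_str ` D = nat_of_str ` D'" using assms(1,2) by (metis finite_imageI set_sorted_list_of_set)
  then show ?thesis by (simp add: inj_image_eq_iff[OF inj])
qed

lemma inj_str_of_nat: "inj str_of_nat"
  by (metis injI str_of_nat_inverse)

lemma enc_inject: "enc s = enc s' \<Longrightarrow> s = s'"
proof -
  assume "enc s = enc s'"
  then have "encode_set (str_of_nat ` set_decode s) = encode_set (str_of_nat ` set_decode s')"
    unfolding enc_def by (metis nat_of_str_inverse)
  then have "str_of_nat ` set_decode s = str_of_nat ` set_decode s'"
    by (intro encode_set_inject) auto
  then have "set_decode s = set_decode s'" by (simp add: inj_image_eq_iff[OF inj_str_of_nat])
  then show "s = s'" by (metis set_decode_inverse)
qed

lemma enc_set_encode: "finite D \<Longrightarrow> enc (set_encode (nat_of_str ` D)) = nat_of_str (encode_set D)"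
  by (simp add: enc_def image_image)

lemma set_decode_less: "x \<in> set_decode s \<Longrightarrow> x < s"
proof -
  assume "x \<in> set_decode s"
  then have "odd (s div 2 ^ x)" by (simp add: set_decode_def)
  then have "s div 2 ^ x \<noteq> 0" by (metis even_zero)
  then have "2 ^ x \<le> s" by (metis div_less not_less)
  with less_exp[of x] show "x < s" by linarith
qed

lemma dec_set_decode [tc_intros]:
  "tc f \<Longrightarrow> tc g \<Longrightarrow> dec (\<lambda>\<phi> n. f \<phi> n \<in> set_decode (g \<phi> n))"
  unfolding set_decode_def mem_Collect_eq by (intro tc_intros)

lemma card_set_decode: "card (set_decode s) = (\<Sum>k<s. of_bool (k \<in> set_decode s))"
proof -
  have "{..<s} \<inter> {k. k \<in> set_decode s} = set_decode s" using set_decode_less by auto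
  then show ?thesis by (simp add: of_bool_def sum.If_cases)
qed

lemma tc_card_set_decode [tc_intros]: "tc f \<Longrightarrow> tc (\<lambda>\<phi> n. card (set_decode (f \<phi> n)))"
  by (rule tc_comp[of "\<lambda>\<phi> n. card (set_decode n)"]) (unfold card_set_decode, intro tc_intros)

lemma nat_of_str_self_delim:
  "nat_of_str (self_delim x) = app (app (2 * 2 ^ length x - 2) 1) (nat_of_str x)"
proof -
  have "nat_of_str (replicate k True) = 2 * 2 ^ k - 2" for k
  proof (induction k)
    case (Suc k)
    obtain y where "(2::nat) ^ k = Suc y" by (metis not0_implies_Suc power_not_zero zero_neq_numeral)
    with Suc show ?case by (simp add: nat_of_str_snoc flip: replicate_append_same)
  qed simp
  moreover have "self_delim x = (replicate (length x) True @ [False]) @ x"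
    by (simp add: self_delim_def)
  moreover have "nat_of_str [False] = 1" by (simp add: nat_of_str_def)
  ultimately show ?thesis by (simp only: app_nat_of_str)
qed

text \<open>Replaces the sorted list in the encoding by a primitive recursion over all
  \<open>k < s\<close> that skips nonmembers, the form in which computability can be shown.\<close>

lemma enc_eq:
  "enc s = app (nat_of_str (self_delim (str_of_nat (card (set_decode s)))))
     (rec_nat 0 (\<lambda>k r. if k \<in> set_decode s then app r (nat_of_str (self_delim (str_of_nat k))) else r) s)"
proof -
  define g where "g = (\<lambda>n. self_delim (str_of_nat n))"
  have "rec_nat 0 (\<lambda>k r. if k \<in> set_decode s then app r (nat_of_str (g k)) else r) m =
      nat_of_str (concat (map g (filter (\<lambda>k. k \<in> set_decode s) [0..<m])))" for m
    by (induction m) (simp_all flip: app_nat_of_str)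
  moreover have "sorted_list_of_set (set_decode s) = filter (\<lambda>k. k \<in> set_decode s) [0..<s]"
  proof -
    have "set_decode s = set (filter (\<lambda>k. k \<in> set_decode s) [0..<s])" using set_decode_less by auto
    then show ?thesis
      by (metis sorted_list_of_set.idem_if_sorted_distinct sorted_wrt_filter sorted_upt distinct_filter distinct_upt)
  qed
  moreover have "card (str_of_nat ` set_decode s) = card (set_decode s)"
    by (rule card_image) (rule inj_on_subset[OF inj_str_of_nat], simp)
  moreover have "nat_of_str ` str_of_nat ` set_decode s = set_decode s" by (simp add: image_image)
  ultimately show ?thesis
    unfolding enc_def encode_set_def app_nat_of_str g_def by simp
qed

lemma tc_enc [tc_intros]: "tc f \<Longrightarrow> tc (\<lambda>\<phi> n. enc (f \<phi> n))"
  by (rule tc_comp[of "\<lambda>\<phi>. enc"])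
    (unfold enc_eq nat_of_str_self_delim len_def[symmetric] str_of_nat_inverse, intro tc_intros)

section \<open>Stages\<close>

text \<open>Numerator of \<open>weight A\<close> over the denominator \<open>2 ^ t\<close> for
  \<open>A\<close> below \<open>t\<close>, where \<open>len p \<le> p < t\<close>. It turns
  comparisons of weights into decidable statements about natural numbers.\<close>

definition wnat :: "nat set \<Rightarrow> nat \<Rightarrow> nat" where
  "wnat A t = (\<Sum>p<t. if p \<in> A then 2 ^ (t - len p) else 0)"

definition weight :: "nat set \<Rightarrow> real" where
  "weight A = (\<Sum>p\<in>A. (1/2) ^ len p)"

lemma weight_eq_wnat:
  assumes "A \<subseteq> {..<t}"
  shows "weight A = wnat A t / 2 ^ t"
proof -
  have "real (if p \<in> A then 2 ^ (t - len p) else 0) / 2 ^ t = (if p \<in> A then (1/2) ^ len p else 0)"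
    if "p < t" for p
  proof -
    have "len p \<le> t" using len_le[of p] that by simp
    then have "(2::real) ^ (t - len p) = 2 ^ t / 2 ^ len p" by (simp add: power_diff)
    then show ?thesis by (simp add: power_one_over)
  qed
  then have "wnat A t / 2 ^ t = (\<Sum>p<t. if p \<in> A then (1/2) ^ len p else 0)"
    unfolding wnat_def of_nat_sum sum_divide_distrib by (intro sum.cong) auto
  also have "\<dots> = weight A"
    using assms unfolding weight_def
    by (subst sum.inter_restrict[symmetric]) (simp_all add: Int_absorb1)
  finally show ?thesis by simp
qed

lemma weight_mono: "finite B \<Longrightarrow> A \<subseteq> B \<Longrightarrow> weight A \<le> weight B"
  unfolding weight_def by (rule sum_mono2) auto

lemma weight_Diff: "finite B \<Longrightarrow> A \<subseteq> B \<Longrightarrow> weight (B - A) = weight B - weight A"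
  unfolding weight_def by (rule sum_diff)

context universal_machine
begin

definition into :: "nat \<Rightarrow> nat \<Rightarrow> nat set" where
  "into t s = {p. p < t \<and> st p t \<noteq> 0 \<and> st p t - 1 \<in> set_decode s}"

text \<open>\<open>into t s\<close> are the programs that print an element of the set with code \<open>s\<close> within \<open>t\<close> steps;
  \<open>p\<close> counts as enumerated only when they have reached half of the weight \<open>2\<^sup>-\<^sup>i\<close>.\<close>

definition codes :: "nat \<Rightarrow> nat \<Rightarrow> nat \<Rightarrow> nat \<Rightarrow> bool" where
  "codes i t p s \<longleftrightarrow> s < t \<and> st p t = Suc (enc s) \<and> (1/2) ^ (i + 1) \<le> weight (into t s)"

definition hal :: "nat \<Rightarrow> nat \<Rightarrow> nat set" where
  "hal i t = {p. p < t \<and> (\<exists>s<t. codes i t p s)}"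

lemma into_subset: "into t s \<subseteq> {..<t}"
  by (auto simp: into_def)

lemma hal_subset: "hal i t \<subseteq> {..<t}"
  by (auto simp: hal_def)

lemma finite_into: "finite (into t s)" and finite_hal: "finite (hal i t)"
  using finite_subset[OF into_subset] finite_subset[OF hal_subset] by auto

lemma into_mono: "t \<le> t' \<Longrightarrow> into t s \<subseteq> into t' s"
proof
  fix p assume "t \<le> t'" "p \<in> into t s"
  moreover from this obtain v where "st p t = Suc v" by (auto simp: into_def gr0_conv_Suc)
  moreover from this have "st p t' = Suc v" using \<open>t \<le> t'\<close> st_mono by blast
  ultimately show "p \<in> into t' s" by (auto simp: into_def)
qed

lemma codes_mono:
  assumes "codes i t p s" "t \<le> t'"
  shows "codes i t' p s"
proof -
  have "st p t' = Suc (enc s)" using assms st_mono unfolding codes_def by blast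
  moreover have "weight (into t s) \<le> weight (into t' s)"
    by (rule weight_mono[OF finite_into into_mono[OF assms(2)]])
  ultimately show ?thesis using assms unfolding codes_def by linarith
qed

lemma hal_mono:
  assumes "t \<le> t'"
  shows "hal i t \<subseteq> hal i t'"
proof
  fix p assume "p \<in> hal i t"
  then obtain s where "p < t" "s < t" "codes i t p s" by (auto simp: hal_def)
  moreover from this have "codes i t' p s" using codes_mono assms by blast
  ultimately show "p \<in> hal i t'" using assms by (auto simp: hal_def intro: less_le_trans)
qed

lemma codes_unique: "codes i t p s \<Longrightarrow> codes i t p s' \<Longrightarrow> s = s'"
  by (auto simp: codes_def intro: enc_inject)

lemma halts_hal: "p \<in> hal i t \<Longrightarrow> halts p"
  unfolding hal_def codes_def using st_halts by blast

lemma weight_halts_le: "finite A \<Longrightarrow> (\<And>p. p \<in> A \<Longrightarrow> halts p) \<Longrightarrow> weight A \<le> 1"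
  unfolding weight_def by (rule kraft_halts)

lemma tc_wnat:
  assumes "dec (\<lambda>\<phi> e. p2 e \<in> A (p1 e))" "tc f" "tc g"
  shows "tc (\<lambda>\<phi> n. wnat (A (f \<phi> n)) (g \<phi> n))"
proof -
  have *: "tc (\<lambda>\<phi> e. of_bool (p2 e \<in> A (p1 e)))" by (rule dec_tc[OF assms(1)])
  have mem: "dec (\<lambda>\<phi> n. y \<phi> n \<in> A (x \<phi> n))" if "tc x" "tc y" for x y
    unfolding dec_def by (rule tc_comp2[of "\<lambda>\<phi> a b. of_bool (b \<in> A a)", OF * that])
  have "tc (\<lambda>\<phi> e. wnat (A (p1 e)) (p2 e))" unfolding wnat_def by (intro tc_intros mem)
  from tc_comp2[OF this assms(2,3)] show ?thesis .
qed

lemma codes_iff: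
  "codes i t p s \<longleftrightarrow> s < t \<and> st p t = Suc (enc s) \<and> 2 ^ t \<le> 2 ^ (i + 1) * wnat (into t s) t"
proof -
  have "(1/2) ^ (i + 1) \<le> weight (into t s) \<longleftrightarrow> (2::real) ^ t \<le> 2 ^ (i + 1) * real (wnat (into t s) t)"
  proof -
    have "(1/2) ^ (i + 1) \<le> w / 2 ^ t \<longleftrightarrow> 2 ^ t / 2 ^ (i + 1) \<le> w" for w :: real
      by (simp only: pos_le_divide_eq zero_less_power zero_less_numeral) (simp add: power_one_over)
    also have "2 ^ t / 2 ^ (i + 1) \<le> w \<longleftrightarrow> 2 ^ t \<le> w * 2 ^ (i + 1)" for w :: real
      by (rule pos_divide_le_eq) simp
    finally show ?thesis unfolding weight_eq_wnat[OF into_subset] by (simp only: mult.commute)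
  qed
  also have "\<dots> \<longleftrightarrow> real (2 ^ t) \<le> real (2 ^ (i + 1) * wnat (into t s) t)" by simp
  finally show ?thesis unfolding codes_def of_nat_le_iff by blast
qed

lemma tc_wnat_into [tc_intros]: "tc f \<Longrightarrow> tc g \<Longrightarrow> tc (\<lambda>\<phi> n. wnat (into (f \<phi> n) (g \<phi> n)) (f \<phi> n))"
proof -
  assume f: "tc f" and g: "tc g"
  have "dec (\<lambda>\<phi> e. p2 e \<in> into (p1 (p1 e)) (p2 (p1 e)))"
    unfolding into_def mem_Collect_eq by (intro tc_intros)
  from tc_wnat[of "\<lambda>e. into (p1 e) (p2 e)", OF this tc_pair[OF f g] f] show ?thesis by simp
qed

lemma dec_codes [tc_intros]:
  "tc a \<Longrightarrow> tc b \<Longrightarrow> tc c \<Longrightarrow> tc d \<Longrightarrow> dec (\<lambda>\<phi> n. codes (a \<phi> n) (b \<phi> n) (c \<phi> n) (d \<phi> n))"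
  unfolding codes_iff by (intro tc_intros)

lemma dec_hal [tc_intros]:
  assumes "tc f" "tc g" "tc h"
  shows "dec (\<lambda>\<phi> n. f \<phi> n \<in> hal (g \<phi> n) (h \<phi> n))"
  unfolding hal_def mem_Collect_eq
  by (intro tc_intros assms tc_comp[OF assms(1)] tc_comp[OF assms(2)] tc_comp[OF assms(3)])

lemma tc_wnat_hal [tc_intros]: "tc f \<Longrightarrow> tc g \<Longrightarrow> tc (\<lambda>\<phi> n. wnat (hal (f \<phi> n) (g \<phi> n)) (g \<phi> n))"
proof -
  assume f: "tc f" and g: "tc g"
  have "dec (\<lambda>\<phi> e. p2 e \<in> hal (p1 (p1 e)) (p2 (p1 e)))" by (intro tc_intros)
  from tc_wnat[of "\<lambda>e. hal (p1 e) (p2 e)", OF this tc_pair[OF f g] g] show ?thesis by simp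
qed

section \<open>Complexity of stages\<close>

definition fl :: "nat \<Rightarrow> nat \<Rightarrow> nat \<Rightarrow> nat" where
  "fl i n t = wnat (hal i t) t * 2 ^ n div 2 ^ t"

lemma fl_eq_floor: "fl i n t = nat \<lfloor>weight (hal i t) * 2 ^ n\<rfloor>"
proof -
  have "weight (hal i t) * 2 ^ n = real (wnat (hal i t) t * 2 ^ n) / real (2 ^ t)"
    unfolding weight_eq_wnat[OF hal_subset] by simp
  then show ?thesis unfolding fl_def by (simp only: floor_divide_of_nat_eq nat_int)
qed

lemma weight_hal_mono: "t \<le> t' \<Longrightarrow> weight (hal i t) \<le> weight (hal i t')"
  by (rule weight_mono[OF finite_hal hal_mono])

lemma weight_hal_le: "weight (hal i t) \<le> 1"
  by (rule weight_halts_le[OF finite_hal halts_hal])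

lemma fl_mono: "t \<le> t' \<Longrightarrow> fl i n t \<le> fl i n t'"
  unfolding fl_eq_floor by (intro nat_mono floor_mono mult_right_mono weight_hal_mono) auto

lemma fl_le: "fl i n t \<le> 2 ^ n"
proof -
  have "weight (hal i t) * 2 ^ n \<le> 1 * 2 ^ n" by (intro mult_right_mono weight_hal_le) simp
  then have "real_of_int \<lfloor>weight (hal i t) * 2 ^ n\<rfloor> \<le> 2 ^ n"
    using of_int_floor_le[of "weight (hal i t) * 2 ^ n"] by linarith
  then have "real_of_int \<lfloor>weight (hal i t) * 2 ^ n\<rfloor> \<le> real_of_int (2 ^ n)"
    by (simp only: of_int_power of_int_numeral)
  then have "\<lfloor>weight (hal i t) * 2 ^ n\<rfloor> \<le> 2 ^ n" by (simp only: of_int_le_iff)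
  then show ?thesis unfolding fl_eq_floor by (simp add: nat_le_iff)
qed

text \<open>Every jump of \<open>fl\<close> requests its stage with length \<open>n\<close>. As
  \<open>fl\<close> is nondecreasing and at most \<open>2 ^ n\<close>, there are at most
  \<open>2 ^ n\<close> requests.\<close>

lemma K_stage: "\<exists>c. \<forall>i n t. fl i n t < fl i n (Suc t) \<longrightarrow> kn (Suc t) \<le> kn (pair n i) + n + c"
proof -
  define r :: "(nat \<Rightarrow> nat) \<Rightarrow> nat \<Rightarrow> nat \<Rightarrow> nat" where
    "r \<phi> u j = (if fl (p2 u) (p1 u) j < fl (p2 u) (p1 u) (Suc j) then Suc (pair (p1 u) (Suc j)) else 0)"
    for \<phi> u j
  have tcr: "tc (\<lambda>\<phi> e. r \<phi> (p1 e) (p2 e))" unfolding r_def fl_def by (intro tc_intros)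
  from K_le_request[where r = r, OF tcr] obtain c where c: "K_bound r c" ..
  have sum: "(\<Sum>j<J. wt (r \<phi> u j)) \<le> 1" for \<phi> u J
  proof -
    have "(\<Sum>j<J. wt (r \<phi> u j)) \<le> fl (p2 u) (p1 u) J / 2 ^ p1 u"
    proof (induction J)
      case (Suc J)
      have "fl (p2 u) (p1 u) J + of_bool (r \<phi> u J \<noteq> 0) \<le> fl (p2 u) (p1 u) (Suc J)"
        using fl_mono[of J "Suc J" "p2 u" "p1 u"] by (auto simp: r_def)
      then have "real (fl (p2 u) (p1 u) J) + of_bool (r \<phi> u J \<noteq> 0) \<le> fl (p2 u) (p1 u) (Suc J)"
        by (metis of_nat_add of_nat_le_iff of_nat_of_bool)
      then have "(real (fl (p2 u) (p1 u) J) + of_bool (r \<phi> u J \<noteq> 0)) / 2 ^ p1 u \<le> fl (p2 u) (p1 u) (Suc J) / 2 ^ p1 u"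
        by (rule divide_right_mono) simp
      moreover have "wt (r \<phi> u J) = of_bool (r \<phi> u J \<noteq> 0) / 2 ^ p1 u"
        by (simp add: wt_def r_def power_one_over)
      ultimately show ?case using Suc by (simp add: add_divide_distrib)
    qed simp
    also have "\<dots> \<le> 1"
    proof -
      have "real (fl (p2 u) (p1 u) J) \<le> real (2 ^ p1 u)" by (simp only: of_nat_le_iff fl_le)
      then show ?thesis by simp
    qed
    finally show ?thesis .
  qed
  have "kn (Suc t) \<le> kn (pair n i) + n + c" if "fl i n t < fl i n (Suc t)" for i n t
  proof -
    have "r (tape (Str [])) (pair n i) t = Suc (pair n (Suc t))" using that by (simp add: r_def)
    from K_boundD[OF c sum this] show ?thesis by (simp add: K_def)
  qed
  then show ?thesis by blast
qed

definition settled :: "nat \<Rightarrow> nat \<Rightarrow> bool" where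
  "settled N t \<longleftrightarrow> (\<forall>q. len q \<le> N \<longrightarrow> halts q \<longrightarrow> st q t \<noteq> 0)"

text \<open>Makes the cost \<open>2 * len n\<close> of naming \<open>n\<close> at most half of
  \<open>n\<close> plus a constant, so that logarithmic terms can be absorbed by linear
  ones.\<close>

lemma four_len_le: "4 * len n \<le> n + 8"
proof -
  have "4 * k \<le> 2 ^ k + 7" for k :: nat
  proof (induction k)
    case (Suc k)
    show ?case
    proof (cases "k \<le> 1")
      case True
      then show ?thesis by (cases k) auto
    next
      case False
      then have "(2::nat) ^ 2 \<le> 2 ^ k" by (intro power_increasing) auto
      with Suc show ?thesis by simp
    qed
  qed simp
  from this[of "len n"] len_bounds(1)[of n] show ?thesis by linarith
qed

text \<open>If the jump stage were settled for \<open>N\<close>, then \<open>N\<close> would be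
  below K(t+1) + K(N) up to a constant. Here K(N) costs at most N/2, and K(t+1) at most n + n/2 +
  i/2, up to constants, so N < 3n + i + O(1); the coefficients 4 and 2 exclude this.\<close>

lemma not_settled_stage:
  "\<exists>C. \<forall>i n t. fl i n t < fl i n (Suc t) \<longrightarrow> \<not> settled (4 * n + 2 * i + C) (Suc t)"
proof -
  obtain c1 where c1: "\<forall>i n t. fl i n t < fl i n (Suc t) \<longrightarrow> kn (Suc t) \<le> kn (pair n i) + n + c1"
    using K_stage ..
  obtain c2 where c2: "\<And>a b. kn (pair a b) \<le> kn a + kn b + c2" using K_pair by blast
  obtain c3 where c3: "\<forall>x. kn x \<le> 2 * len x + c3" using K_le_len ..
  obtain c4 where c4: "\<And>t N. (\<And>p. halts p \<Longrightarrow> len p \<le> N \<Longrightarrow> st p t \<noteq> 0) \<Longrightarrow> N < kn (pair t N) + c4"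
    using K_halting_time by blast
  define C where "C = 2 * c1 + 4 * c2 + 6 * c3 + 2 * c4 + 40"
  have "\<not> settled (4 * n + 2 * i + C) (Suc t)" if "fl i n t < fl i n (Suc t)" for i n t
  proof
    define N where "N = 4 * n + 2 * i + C"
    assume "settled (4 * n + 2 * i + C) (Suc t)"
    then have "N < kn (pair (Suc t) N) + c4" by (intro c4) (simp add: settled_def N_def)
    moreover have "kn (pair (Suc t) N) \<le> kn (Suc t) + kn N + c2" by (rule c2)
    moreover have "kn (Suc t) \<le> kn (pair n i) + n + c1" using c1 that by blast
    moreover have "kn (pair n i) \<le> kn n + kn i + c2" by (rule c2)
    moreover have "kn n \<le> 2 * len n + c3" "kn i \<le> 2 * len i + c3" "kn N \<le> 2 * len N + c3"
      using c3 by blast+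
    moreover note four_len_le[of n] four_len_le[of i] four_len_le[of N]
    ultimately show False unfolding N_def C_def by linarith
  qed
  then show ?thesis by blast
qed

text \<open>Programs of total weight at most 2^-d can be re-encoded with \<open>d\<close> bits less.
  Truncated subtraction does no harm, as it can only lengthen a request.\<close>

lemma sum_shifted_le:
  assumes "weight A \<le> (1/2) ^ d"
  shows "(\<Sum>p\<in>A. (1/2 :: real) ^ (len p - d)) \<le> 1"
proof -
  have "(1/2::real) ^ (len p - d) \<le> 2 ^ d * (1/2) ^ len p" for p
  proof -
    have "(1/2::real) ^ (len p - d) = 2 ^ d * (1/2) ^ (d + (len p - d))"
      by (simp add: power_add power_one_over)
    also have "\<dots> \<le> 2 ^ d * (1/2) ^ len p" by (intro mult_left_mono power_decreasing) auto
    finally show ?thesis .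
  qed
  then have "(\<Sum>p\<in>A. (1/2 :: real) ^ (len p - d)) \<le> (\<Sum>p\<in>A. 2 ^ d * (1/2) ^ len p)"
    by (intro sum_mono)
  also have "\<dots> = 2 ^ d * weight A" by (simp add: weight_def sum_distrib_left)
  also have "\<dots> \<le> 2 ^ d * (1/2) ^ d" using assms by (intro mult_left_mono) auto
  also have "\<dots> = 1" by (simp add: power_one_over)
  finally show ?thesis .
qed

text \<open>Indices pack the described object with an auxiliary witness, a stage or a hitting set.
  If the witness is unique, no object is counted twice.\<close>

lemma sum_wt_le:
  fixes J :: nat
  assumes "finite A" "\<And>j. Q j \<Longrightarrow> p1 j \<in> A" "\<And>i j. Q i \<Longrightarrow> Q j \<Longrightarrow> p2 i = p2 j"
  shows "(\<Sum>j<J. wt (if Q j then Suc (pair (k (p1 j)) (x j)) else 0)) \<le> (\<Sum>p\<in>A. (1/2) ^ k p)"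
proof -
  define F where "F = {j. j < J \<and> Q j}"
  have inj: "inj_on p1 F" unfolding F_def by (rule inj_onI) (metis (mono_tags) assms(3) mem_Collect_eq pair_p1_p2)
  have "(\<Sum>j<J. wt (if Q j then Suc (pair (k (p1 j)) (x j)) else 0)) = (\<Sum>p\<in>p1 ` F. (1/2) ^ k p)"
    unfolding sum_wt F_def[symmetric] by (simp add: sum.reindex[OF inj])
  also have "\<dots> \<le> (\<Sum>p\<in>A. (1/2) ^ k p)"
    using assms(1,2) by (intro sum_mono2) (auto simp: F_def)
  finally show ?thesis .
qed

text \<open>The halting sequence yields the first stage settled for a given length; \<open>\<tau>\<close> records that
  \<open>p\<close> was enumerated among the last \<open>2\<^sup>-\<^sup>n\<close> of the weight.\<close>

lemma Kc_halting_seq: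
  "\<exists>c. \<forall>i n p \<tau> t y. settled (4 * n + 2 * i + C) t \<longrightarrow> (\<forall>t'<t. \<not> settled (4 * n + 2 * i + C) t') \<longrightarrow>
     p \<in> hal i t \<longrightarrow> \<tau> < t \<longrightarrow> p \<notin> hal i \<tau> \<longrightarrow>
     weight (hal i t) - weight (hal i \<tau>) \<le> (1/2) ^ n \<longrightarrow> st p t = Suc y \<longrightarrow>
     Kc U (str_of_nat y) (Seq (halting_seq U)) \<le> kn (pair n i) + (len p - n) + c"
proof -
  \<comment> \<open>The form of \<open>settled\<close> that is decidable from the halting sequence:
    \<open>\<phi> q = 1\<close> stands for halting, and strings of length at most \<open>N\<close>
    have numbers below \<open>2 ^ (N + 1)\<close>.\<close>
  define sett where "sett \<phi> N t \<longleftrightarrow> (\<forall>q<2 ^ (N + 1). len q \<le> N \<and> \<phi> q = 1 \<longrightarrow> st q t \<noteq> 0)"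
    for \<phi> :: "nat \<Rightarrow> nat" and N t
  \<comment> \<open>The bound 2^-n on the weight gained between the two stages, with the
    denominators \<open>2 ^ t\<close>, \<open>2 ^ \<tau>\<close> and \<open>2 ^ n\<close>
    cleared.\<close>
  define small where "small i n \<tau> t \<longleftrightarrow>
      wnat (hal i t) t * 2 ^ n * 2 ^ \<tau> \<le> wnat (hal i \<tau>) \<tau> * 2 ^ n * 2 ^ t + 2 ^ t * 2 ^ \<tau>" for i n \<tau> t
  have small: "small i n \<tau> t \<longleftrightarrow> weight (hal i t) - weight (hal i \<tau>) \<le> (1/2) ^ n" for i n \<tau> t
  proof -
    have "W / a - V / b \<le> 1 / d \<longleftrightarrow> W * d * b \<le> V * d * a + a * b" if "0 < a" "0 < b" "0 < d"
      for W V a b d :: real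
    proof -
      have "W / a - V / b \<le> 1 / d \<longleftrightarrow> (W / a - V / b) * (a * b * d) \<le> 1 / d * (a * b * d)"
        using that by (intro mult_le_cancel_right_pos[symmetric]) simp
      also have "(W / a - V / b) * (a * b * d) = W * d * b - V * d * a"
        using that by (simp add: left_diff_distrib)
      also have "1 / d * (a * b * d) = a * b" using that by simp
      finally show ?thesis by linarith
    qed
    from this[of "2 ^ t" "2 ^ \<tau>" "2 ^ n" "real (wnat (hal i t) t)" "real (wnat (hal i \<tau>) \<tau>)"]
    have "weight (hal i t) - weight (hal i \<tau>) \<le> (1/2) ^ n \<longleftrightarrow>
        real (wnat (hal i t) t * 2 ^ n * 2 ^ \<tau>) \<le> real (wnat (hal i \<tau>) \<tau> * 2 ^ n * 2 ^ t + 2 ^ t * 2 ^ \<tau>)"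
      unfolding weight_eq_wnat[OF hal_subset] power_one_over by simp
    then show ?thesis unfolding small_def of_nat_le_iff by blast
  qed
  define last where "last i n t p \<longleftrightarrow> p \<in> hal i t \<and> (\<exists>\<tau><t. p \<notin> hal i \<tau> \<and> small i n \<tau> t)" for i n t p
  \<comment> \<open>Admitting only the first settled stage makes the stage a function of the
    parameter, so that different stages do not compete for weight.\<close>
  define Q where "Q \<phi> u j \<longleftrightarrow> (let N = 4 * p1 u + 2 * p2 u + C; t = p2 j in
      sett \<phi> N t \<and> (\<forall>t'<t. \<not> sett \<phi> N t') \<and> last (p2 u) (p1 u) t (p1 j))" for \<phi> u j
  define r :: "(nat \<Rightarrow> nat) \<Rightarrow> nat \<Rightarrow> nat \<Rightarrow> nat" where
    "r \<phi> u j = (if Q \<phi> u j then Suc (pair (len (p1 j) - p1 u) (st (p1 j) (p2 j) - 1)) else 0)" for \<phi> u j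
  have tcr: "tc (\<lambda>\<phi> e. r \<phi> (p1 e) (p2 e))"
    unfolding r_def Q_def Let_def sett_def last_def small_def by (intro tc_intros)
  from K_le_request[where r = r, OF tcr] obtain c where c: "K_bound r c" ..
  have weight_last: "weight {p. last i n t p} \<le> (1/2) ^ n" for i n t
  proof (cases "\<exists>\<tau><t. small i n \<tau> t")
    case True
    \<comment> \<open>One stage serves all programs: a program absent at its own witness \<tau> is
      also absent at the least witness, so all of them lie in the weight gained after that one
      stage.\<close>
    define \<tau>0 where "\<tau>0 = (LEAST \<tau>. \<tau> < t \<and> small i n \<tau> t)"
    have \<tau>0: "\<tau>0 < t \<and> small i n \<tau>0 t" unfolding \<tau>0_def using True by (rule LeastI_ex)
    have "{p. last i n t p} \<subseteq> hal i t - hal i \<tau>0"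
    proof
      fix p assume "p \<in> {p. last i n t p}"
      then obtain \<tau> where p: "p \<in> hal i t" "p \<notin> hal i \<tau>" and "\<tau> < t \<and> small i n \<tau> t"
        by (auto simp: last_def)
      then have "\<tau>0 \<le> \<tau>" unfolding \<tau>0_def by (intro Least_le)
      with p show "p \<in> hal i t - hal i \<tau>0" using hal_mono by blast
    qed
    then have "weight {p. last i n t p} \<le> weight (hal i t - hal i \<tau>0)"
      by (intro weight_mono finite_Diff finite_hal)
    also have "\<dots> = weight (hal i t) - weight (hal i \<tau>0)"
      using \<tau>0 by (intro weight_Diff finite_hal hal_mono) simp
    finally show ?thesis using \<tau>0 small by (meson order.trans)
  next
    case False
    then have "{p. last i n t p} = {}" by (auto simp: last_def)
    then show ?thesis by (simp add: weight_def)
  qed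
  have sum: "(\<Sum>j<J. wt (r \<phi> u j)) \<le> 1" for \<phi> u J
  proof (cases "\<exists>j. Q \<phi> u j")
    case True
    then obtain j0 where j0: "Q \<phi> u j0" ..
    define t n i where "t = p2 j0" and "n = p1 u" and "i = p2 u"
    have fin: "finite {p. last i n t p}" by (rule finite_subset[OF _ finite_hal[of i t]]) (auto simp: last_def)
    have snd: "p2 j = p2 j'" if "Q \<phi> u j" "Q \<phi> u j'" for j j'
    proof -
      have "\<not> p2 j < p2 j'" "\<not> p2 j' < p2 j" using that unfolding Q_def Let_def by auto
      then show ?thesis by simp
    qed
    have fst: "p1 j \<in> {p. last i n t p}" if "Q \<phi> u j" for j
      using that snd[OF that j0] unfolding Q_def Let_def n_def i_def t_def by auto
    have "(\<Sum>j<J. wt (r \<phi> u j)) \<le> (\<Sum>p\<in>{p. last i n t p}. (1/2) ^ (len p - n))"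
      unfolding r_def n_def[symmetric]
      by (rule sum_wt_le[where k = "\<lambda>p. len p - n" and Q = "Q \<phi> u", OF fin fst snd])
    also have "\<dots> \<le> 1" by (rule sum_shifted_le[OF weight_last])
    finally show ?thesis .
  qed (simp add: r_def wt_def)
  have "Kc U (str_of_nat y) (Seq (halting_seq U)) \<le> kn (pair n i) + (len p - n) + c"
    if a: "settled (4 * n + 2 * i + C) t" "\<forall>t'<t. \<not> settled (4 * n + 2 * i + C) t'"
      "p \<in> hal i t" "\<tau> < t" "p \<notin> hal i \<tau>"
      "weight (hal i t) - weight (hal i \<tau>) \<le> (1/2) ^ n" "st p t = Suc y" for i n p \<tau> t y
  proof -
    define \<phi> where "\<phi> = tape (Seq (halting_seq U))"
    have "sett \<phi> N t \<longleftrightarrow> settled N t" for N t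
    proof -
      have "q < 2 ^ (N + 1)" if "len q \<le> N" for q
        using len_bounds(2)[of q] power_increasing[of "len q + 1" "N + 1" "2::nat"] that by linarith
      moreover have "\<phi> q = 1 \<longleftrightarrow> halts q" for q by (simp add: \<phi>_def halting_seq_def halts_def)
      ultimately show ?thesis unfolding sett_def settled_def by blast
    qed
    then have "Q \<phi> (pair n i) (pair p t)"
      using a(1-6) unfolding Q_def Let_def last_def small by auto
    then have "r \<phi> (pair n i) (pair p t) = Suc (pair (len p - n) y)" using a(7) by (simp add: r_def)
    from K_boundD[OF c sum this[unfolded \<phi>_def]] show ?thesis .
  qed
  then show ?thesis by blast
qed

end

section \<open>Hitting sets\<close>

text \<open>Averaging: an element \<open>f g\<close> drawn with weight \<open>w g\<close> lies in
  each \<open>S p\<close> with weight at least \<open>e\<close>, so after exchanging the sums some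
  element hits a fraction \<open>e\<close> of the remaining \<open>v\<close>-weight. Each greedy
  choice leaves a factor \<open>1 - e\<close>.\<close>

lemma greedy_hitting:
  fixes v :: "'a \<Rightarrow> real" and w :: "'b \<Rightarrow> real" and f :: "'b \<Rightarrow> 'c"
  assumes "finite P" "finite G" and w: "\<And>g. g \<in> G \<Longrightarrow> 0 < w g" "sum w G \<le> 1"
    and v: "\<And>p. p \<in> P \<Longrightarrow> 0 \<le> v p" and e: "0 < e" "e \<le> 1"
    and S: "\<And>p. p \<in> P \<Longrightarrow> e \<le> sum w {g \<in> G. f g \<in> S p}"
  shows "\<exists>X. finite X \<and> card X \<le> k \<and> sum v {p \<in> P. S p \<inter> X = {}} \<le> (1 - e) ^ k * sum v P"
proof (induction k)
  case 0
  then show ?case by (intro exI[of _ "{}"]) simp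
next
  case (Suc k)
  then obtain X where X: "finite X" "card X \<le> k"
    "sum v {p \<in> P. S p \<inter> X = {}} \<le> (1 - e) ^ k * sum v P" by blast
  define R where "R = {p \<in> P. S p \<inter> X = {}}"
  have R: "finite R" "R \<subseteq> P" using \<open>finite P\<close> by (auto simp: R_def)
  have "\<exists>y. e * sum v R \<le> sum v {p \<in> R. y \<in> S p}"
  proof (rule ccontr)
    assume "\<not> ?thesis"
    then have less: "sum v {p \<in> R. y \<in> S p} < e * sum v R" for y by (simp add: not_le)
    have "0 \<le> sum v {p \<in> R. y \<in> S p}" for y using R v by (intro sum_nonneg) auto
    with less have pos: "0 < e * sum v R" by (meson order.strict_trans1)
    have "e * sum v R = (\<Sum>p\<in>R. v p * e)" by (simp add: sum_distrib_left mult.commute)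
    also have "\<dots> \<le> (\<Sum>p\<in>R. v p * sum w {g \<in> G. f g \<in> S p})"
      using R S v by (intro sum_mono mult_left_mono) auto
    also have "\<dots> = (\<Sum>p\<in>R. \<Sum>g\<in>G. if f g \<in> S p then v p * w g else 0)"
      using \<open>finite G\<close> by (auto simp: sum_distrib_left sum.inter_filter intro!: sum.cong)
    also have "\<dots> = (\<Sum>g\<in>G. \<Sum>p\<in>R. if f g \<in> S p then v p * w g else 0)"
      by (rule sum.swap)
    also have "\<dots> = (\<Sum>g\<in>G. w g * sum v {p \<in> R. f g \<in> S p})"
      using R by (auto simp: sum_distrib_left sum.inter_filter mult.commute intro!: sum.cong)
    finally have le: "e * sum v R \<le> (\<Sum>g\<in>G. w g * sum v {p \<in> R. f g \<in> S p})" .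
    with pos have "G \<noteq> {}" by auto
    then have "(\<Sum>g\<in>G. w g * sum v {p \<in> R. f g \<in> S p}) < (\<Sum>g\<in>G. w g * (e * sum v R))"
      using \<open>finite G\<close> w less by (intro sum_strict_mono mult_strict_left_mono) auto
    also have "\<dots> = sum w G * (e * sum v R)" by (simp add: sum_distrib_right)
    also have "\<dots> \<le> e * sum v R" using mult_right_mono[OF w(2), of "e * sum v R"] pos by simp
    finally show False using le by simp
  qed
  then obtain y where y: "e * sum v R \<le> sum v {p \<in> R. y \<in> S p}" ..
  have "{p \<in> P. S p \<inter> insert y X = {}} = R - {p \<in> R. y \<in> S p}" by (auto simp: R_def)
  then have "sum v {p \<in> P. S p \<inter> insert y X = {}} = sum v R - sum v {p \<in> R. y \<in> S p}"
    using R by (simp add: sum_diff)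
  also have "\<dots> \<le> (1 - e) * sum v R" using y by (simp add: algebra_simps)
  also have "\<dots> \<le> (1 - e) * ((1 - e) ^ k * sum v P)"
    using X(3) e unfolding R_def by (intro mult_left_mono) auto
  finally have "sum v {p \<in> P. S p \<inter> insert y X = {}} \<le> (1 - e) ^ Suc k * sum v P" by simp
  moreover have "card (insert y X) \<le> Suc k" using X by (simp add: card_insert_if)
  ultimately show ?case using X(1) by (intro exI[of _ "insert y X"]) simp
qed

lemma one_minus_power_le_half:
  assumes "0 < N"
  shows "(1 - 1 / real N) ^ N \<le> 1 / 2"
proof -
  have "(1 - 1 / real N) ^ N \<le> exp (- (1 / real N)) ^ N"
    using exp_ge_add_one_self[of "- (1 / real N)"] assms by (intro power_mono) auto
  also have "\<dots> = exp (- 1)" using assms by (simp flip: exp_of_nat_mult)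
  also have "\<dots> \<le> 1 / 2" using exp_ge_add_one_self[of 1] by (simp add: exp_minus field_simps)
  finally show ?thesis .
qed

context universal_machine
begin

text \<open>Disjointness is tested below \<open>t\<close> only, to keep it decidable; this suffices
  because members of a set with code \<open>s < t\<close> are smaller than \<open>t\<close>.\<close>

definition unhit :: "nat \<Rightarrow> nat \<Rightarrow> nat \<Rightarrow> nat set" where
  "unhit i t W = {p. p < t \<and> (\<exists>s<t. codes i t p s \<and> (\<forall>x<t. \<not> (x \<in> set_decode s \<and> x \<in> set_decode W)))}"

lemma unhit_subset: "unhit i t W \<subseteq> {..<t}"
  by (auto simp: unhit_def)

lemma finite_unhit: "finite (unhit i t W)"
  by (rule finite_subset[OF unhit_subset]) simp

lemma unhit_iff:
  assumes "codes i t p s"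
  shows "p \<in> unhit i t W \<longleftrightarrow> p < t \<and> set_decode s \<inter> set_decode W = {}"
proof -
  have "s < t" using assms by (simp add: codes_def)
  then have "(\<forall>x<t. \<not> (x \<in> set_decode s \<and> x \<in> set_decode W)) \<longleftrightarrow> set_decode s \<inter> set_decode W = {}"
    using set_decode_less by fastforce
  moreover have "s' = s" if "codes i t p s'" for s' using codes_unique[OF that assms] .
  ultimately show ?thesis using assms \<open>s < t\<close> unfolding unhit_def by blast
qed

text \<open>Greedy choice with \<open>e\<close> = 2^-(i+1), the share of the halted programs' weight
  that \<open>codes\<close> guarantees to each set. Every block of \<open>2 ^ (i + 1)\<close>
  choices at least halves the missed weight.\<close>

lemma exists_hitting:
  "\<exists>W. card (set_decode W) \<le> 2 ^ (i + 1) * d \<and> weight (unhit i t W) \<le> (1/2) ^ d"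
proof -
  define S where "S p = set_decode (SOME s. codes i t p s)" for p
  have S: "S p = set_decode s" if "codes i t p s" for p s
  proof -
    have "(SOME s. codes i t p s) = s" using that codes_unique by (intro some_equality) blast+
    then show ?thesis by (simp add: S_def)
  qed
  define G where "G = {g. g < t \<and> st g t \<noteq> 0}"
  have G: "finite G" "\<And>g. g \<in> G \<Longrightarrow> halts g" by (auto simp: G_def halts_iff)
  define e :: real where "e = (1/2) ^ (i + 1)"
  have e: "0 < e" "e \<le> 1" unfolding e_def by (simp, intro power_le_one) simp_all
  have "\<exists>X. finite X \<and> card X \<le> 2 ^ (i + 1) * d \<and>
      (\<Sum>p\<in>{p \<in> hal i t. S p \<inter> X = {}}. (1/2::real) ^ len p) \<le>
        (1 - e) ^ (2 ^ (i + 1) * d) * (\<Sum>p\<in>hal i t. (1/2) ^ len p)"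
  proof (rule greedy_hitting[where w = "\<lambda>g. (1/2) ^ len g" and G = G and f = "\<lambda>g. st g t - 1"])
    show "0 < e" "e \<le> 1" by (fact e)+
    show "(\<Sum>g\<in>G. (1/2::real) ^ len g) \<le> 1" by (rule kraft_halts[OF G])
    fix p assume "p \<in> hal i t"
    then obtain s where s: "codes i t p s" by (auto simp: hal_def)
    have "{g \<in> G. st g t - 1 \<in> S p} = into t s" unfolding G_def into_def S[OF s] by blast
    then show "e \<le> (\<Sum>g\<in>{g \<in> G. st g t - 1 \<in> S p}. (1/2) ^ len g)"
      using s unfolding e_def codes_def weight_def by simp
  qed (auto simp: finite_hal G)
  then obtain X where X: "finite X" "card X \<le> 2 ^ (i + 1) * d"
    "(\<Sum>p\<in>{p \<in> hal i t. S p \<inter> X = {}}. (1/2::real) ^ len p) \<le>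
        (1 - e) ^ (2 ^ (i + 1) * d) * weight (hal i t)" unfolding weight_def by blast
  have "unhit i t (set_encode X) = {p \<in> hal i t. S p \<inter> X = {}}"
  proof (intro set_eqI)
    fix p
    show "p \<in> unhit i t (set_encode X) \<longleftrightarrow> p \<in> {p \<in> hal i t. S p \<inter> X = {}}"
    proof (cases "\<exists>s. codes i t p s")
      case True
      then obtain s where s: "codes i t p s" ..
      moreover from s have "s < t" by (simp add: codes_def)
      ultimately have "p \<in> hal i t \<longleftrightarrow> p < t" by (auto simp: hal_def)
      then show ?thesis using unhit_iff[OF s] S[OF s] X(1) by simp
    qed (auto simp: unhit_def hal_def)
  qed
  then have "weight (unhit i t (set_encode X)) \<le> (1 - e) ^ (2 ^ (i + 1) * d) * weight (hal i t)"
    using X(3) by (simp add: weight_def)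
  also have "\<dots> \<le> (1 - e) ^ (2 ^ (i + 1) * d) * 1"
    by (intro mult_left_mono weight_hal_le zero_le_power) (simp add: e)
  also have "\<dots> = ((1 - 1 / real (2 ^ (i + 1))) ^ (2 ^ (i + 1))) ^ d"
    by (simp add: e_def power_mult power_one_over)
  also have "\<dots> \<le> (1/2) ^ d"
    by (intro power_mono one_minus_power_le_half) simp_all
  finally show ?thesis using X by (intro exI[of _ "set_encode X"]) simp
qed

lemma tc_wnat_unhit [tc_intros]:
  assumes "tc f" "tc g" "tc h"
  shows "tc (\<lambda>\<phi> n. wnat (unhit (f \<phi> n) (g \<phi> n) (h \<phi> n)) (g \<phi> n))"
proof -
  have "dec (\<lambda>\<phi> e. p2 e \<in> unhit (p1 (p1 e)) (p1 (p2 (p1 e))) (p2 (p2 (p1 e))))"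
    unfolding unhit_def mem_Collect_eq by (intro tc_intros)
  from tc_wnat[of "\<lambda>e. unhit (p1 e) (p1 (p2 e)) (p2 (p2 e))",
      OF this tc_pair[OF assms(1) tc_pair[OF assms(2,3)]] assms(2)]
  show ?thesis by simp
qed

definition good :: "nat \<Rightarrow> nat \<Rightarrow> nat \<Rightarrow> nat \<Rightarrow> bool" where
  "good d i t W \<longleftrightarrow> card (set_decode W) \<le> 2 ^ (i + 1) * d \<and> wnat (unhit i t W) t * 2 ^ d \<le> 2 ^ t"

text \<open>Taking the least good \<open>W\<close> makes it a function of \<open>d\<close>,
  \<open>i\<close> and \<open>t\<close>, so it needs no description of its own.\<close>

definition first_good :: "nat \<Rightarrow> nat \<Rightarrow> nat \<Rightarrow> nat \<Rightarrow> bool" where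
  "first_good d i t W \<longleftrightarrow> good d i t W \<and> (\<forall>V<W. \<not> good d i t V)"

lemma good_iff:
  "good d i t W \<longleftrightarrow> card (set_decode W) \<le> 2 ^ (i + 1) * d \<and> weight (unhit i t W) \<le> (1/2) ^ d"
proof -
  have "w / 2 ^ t \<le> (1/2) ^ d \<longleftrightarrow> w * 2 ^ d \<le> 2 ^ t" for w :: real
    by (simp add: power_one_over divide_simps)
  then have "weight (unhit i t W) \<le> (1/2) ^ d \<longleftrightarrow> real (wnat (unhit i t W) t) * 2 ^ d \<le> 2 ^ t"
    unfolding weight_eq_wnat[OF unhit_subset] .
  also have "\<dots> \<longleftrightarrow> real (wnat (unhit i t W) t * 2 ^ d) \<le> real (2 ^ t)" by simp
  finally show ?thesis unfolding good_def of_nat_le_iff by blast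
qed

lemma dec_first_good [tc_intros]:
  assumes "tc d" "tc i" "tc t" "tc w"
  shows "dec (\<lambda>\<phi> n. first_good (d \<phi> n) (i \<phi> n) (t \<phi> n) (w \<phi> n))"
  unfolding first_good_def good_def
  by (intro tc_intros assms assms[THEN tc_comp])

lemma first_good_unique: "first_good d i t W \<Longrightarrow> first_good d i t V \<Longrightarrow> W = V"
  unfolding first_good_def by (metis linorder_neqE_nat)

lemma exists_first_good: "\<exists>W. first_good d i t W"
proof -
  have "\<exists>W. good d i t W" using exists_hitting by (simp add: good_iff)
  then have "first_good d i t (LEAST W. good d i t W)"
    unfolding first_good_def using LeastI_ex not_less_Least by blast
  then show ?thesis ..
qed

text \<open>The hitting set is required to be better than the length of \<open>q\<close> accounts for, so that a
  missed code would have a program shorter than its shortest one.\<close>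

lemma K_hitting:
  "\<exists>C c. \<forall>i t s p. codes i t p s \<longrightarrow> p < t \<longrightarrow> len p = kn (enc s) \<longrightarrow>
     (\<exists>x\<in>set_decode s. kn x \<le> i + kn (pair (pair t i) C) + len (kn (pair (pair t i) C) + C) + c)"
proof -
  \<comment> \<open>Here \<open>v = pair q u\<close> with \<open>u = pair (pair t i) C\<close>, so
    \<open>d\<close> is \<open>len q + C\<close>. This is why requests may inspect the parameter
    program and not only its output.\<close>
  define d where "d v = len (p1 v) + p2 (p2 v)" for v
  define t where "t v = p1 (p1 (p2 v))" for v
  define i where "i v = p2 (p1 (p2 v))" for v
  define Q1 where "Q1 v j \<longleftrightarrow> first_good (d v) (i v) (t v) (p2 j) \<and> p1 j \<in> unhit (i v) (t v) (p2 j)" for v j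
  define Q2 where "Q2 v j \<longleftrightarrow> first_good (d v) (i v) (t v) (p2 j) \<and> p1 j \<in> set_decode (p2 j)" for v j
  define r1 :: "(nat \<Rightarrow> nat) \<Rightarrow> nat \<Rightarrow> nat \<Rightarrow> nat" where
    "r1 \<phi> v j = (if Q1 v j then Suc (pair (len (p1 j) - d v) (st (p1 j) (t v) - 1)) else 0)" for \<phi> v j
  \<comment> \<open>The length comes from \<open>card W \<le> 2 ^ (i + 1) * d\<close> and
    \<open>d < 2 ^ (len d + 1)\<close>: members of \<open>W\<close> can all be given the same
    length.\<close>
  define r2 :: "(nat \<Rightarrow> nat) \<Rightarrow> nat \<Rightarrow> nat \<Rightarrow> nat" where
    "r2 \<phi> v j = (if Q2 v j then Suc (pair (i v + 2 + len (d v)) (p1 j)) else 0)" for \<phi> v j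
  have tcr1: "tc (\<lambda>\<phi> e. r1 \<phi> (p1 e) (p2 e))"
    unfolding r1_def Q1_def unhit_def mem_Collect_eq d_def t_def i_def by (intro tc_intros)
  have tcr2: "tc (\<lambda>\<phi> e. r2 \<phi> (p1 e) (p2 e))"
    unfolding r2_def Q2_def d_def t_def i_def by (intro tc_intros)
  from kraft_chaitin[where r = r1, OF tcr1] obtain c1 where c1: "program_bound r1 c1" ..
  from kraft_chaitin[where r = r2, OF tcr2] obtain c2 where c2: "program_bound r2 c2" ..
  have sum1: "(\<Sum>j<J. wt (r1 \<phi> v j)) \<le> 1" for \<phi> v J
  proof -
    obtain W where W: "first_good (d v) (i v) (t v) W" using exists_first_good by blast
    have Q: "p2 j = W" if "Q1 v j" for j using that first_good_unique[OF _ W] by (simp add: Q1_def)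
    have "p1 j \<in> unhit (i v) (t v) W" if "Q1 v j" for j using that Q[OF that] by (simp add: Q1_def)
    moreover have "p2 j = p2 j'" if "Q1 v j" "Q1 v j'" for j j' using Q that by metis
    ultimately have "(\<Sum>j<J. wt (r1 \<phi> v j)) \<le> (\<Sum>p\<in>unhit (i v) (t v) W. (1/2) ^ (len p - d v))"
      unfolding r1_def by (rule sum_wt_le[where k = "\<lambda>p. len p - d v" and Q = "Q1 v", OF finite_unhit])
    also have "\<dots> \<le> 1" using W by (intro sum_shifted_le) (simp add: first_good_def good_iff)
    finally show ?thesis .
  qed
  have sum2: "(\<Sum>j<J. wt (r2 \<phi> v j)) \<le> 1" for \<phi> v J
  proof -
    obtain W where W: "first_good (d v) (i v) (t v) W" using exists_first_good by blast
    have Q: "p2 j = W" if "Q2 v j" for j using that first_good_unique[OF _ W] by (simp add: Q2_def)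
    have "p1 j \<in> set_decode W" if "Q2 v j" for j using that Q[OF that] by (simp add: Q2_def)
    moreover have "p2 j = p2 j'" if "Q2 v j" "Q2 v j'" for j j' using Q that by metis
    ultimately have "(\<Sum>j<J. wt (r2 \<phi> v j)) \<le> (\<Sum>p\<in>set_decode W. (1/2) ^ (i v + 2 + len (d v)))"
      unfolding r2_def
      by (rule sum_wt_le[where k = "\<lambda>p. i v + 2 + len (d v)" and Q = "Q2 v", OF finite_set_decode])
    also have "\<dots> = card (set_decode W) / 2 ^ (i v + 2 + len (d v))" by (simp add: power_one_over)
    also have "\<dots> \<le> 1"
    proof -
      have "card (set_decode W) \<le> 2 ^ (i v + 1) * d v" using W by (simp add: first_good_def good_iff)
      also have "\<dots> \<le> 2 ^ (i v + 1) * 2 ^ (len (d v) + 1)"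
        using len_bounds(2)[of "d v"] by (intro mult_left_mono) auto
      also have "\<dots> = 2 ^ (i v + 2 + len (d v))" by (simp flip: power_add)
      finally have "real (card (set_decode W)) \<le> real (2 ^ (i v + 2 + len (d v)))"
        by (simp only: of_nat_le_iff)
      then show ?thesis by simp
    qed
    finally show ?thesis .
  qed
  \<comment> \<open>Via \<open>r1\<close> a missed \<open>p\<close> would yield a program for
    \<open>enc s\<close> of length at most \<open>len q + (len p - d) + c1 = len p - C + c1\<close>,
    one bit below the shortest. As \<open>c1\<close> is known only once \<open>r1\<close> is fixed,
    \<open>C\<close> enters through the parameter.\<close>
  define C where "C = c1 + 1"
  have "\<exists>x\<in>set_decode s. kn x \<le> i' + kn (pair (pair t' i') C) + len (kn (pair (pair t' i') C) + C) + (c2 + 2)"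
    if codes: "codes i' t' p s" and p: "p < t'" "len p = kn (enc s)" for i' t' s p
  proof -
    define u where "u = pair (pair t' i') C"
    obtain q \<tau> where q: "st q \<tau> = Suc u" "len q = kn u" using K_attained by blast
    define v where "v = pair q u"
    have v: "t v = t'" "i v = i'" "d v = kn u + C"
      by (simp_all add: v_def u_def t_def i_def d_def q(2)[unfolded u_def])
    obtain W where W: "first_good (d v) i' t' W" using exists_first_good by blast
    have "p \<notin> unhit i' t' W"
    proof
      assume un: "p \<in> unhit i' t' W"
      have "(1/2) ^ len p = weight {p}" by (simp add: weight_def)
      also have "\<dots> \<le> weight (unhit i' t' W)" using un by (intro weight_mono finite_unhit) simp
      also have "\<dots> \<le> (1/2) ^ d v" using W by (simp add: first_good_def good_iff)
      finally have "d v \<le> len p" by simp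
      have "r1 (tape (Str [])) (pair q u) (pair p W) = Suc (pair (len p - d v) (enc s))"
        using W un codes unfolding v_def[symmetric] by (simp add: r1_def Q1_def v(1,2) codes_def)
      with c1 q(1) sum1 obtain z where "U (Str []) z = Some (str_of_nat (enc s))"
        "length z \<le> len q + (len p - d v) + c1"
        unfolding program_bound_def by blast
      then have "kn (enc s) \<le> len q + (len p - d v) + c1" unfolding K_def using Kc_le order.trans by blast
      then show False using \<open>d v \<le> len p\<close> p(2) q(2) v(3) by (simp add: C_def)
    qed
    then obtain x where x: "x \<in> set_decode s" "x \<in> set_decode W" using unhit_iff[OF codes] p(1) by blast
    have "r2 (tape (Str [])) (pair q u) (pair x W) = Suc (pair (i' + 2 + len (d v)) x)"
      using W x unfolding v_def[symmetric] by (simp add: r2_def Q2_def v(1,2))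
    with c2 q(1) sum2 obtain z where "U (Str []) z = Some (str_of_nat x)"
      "length z \<le> len q + (i' + 2 + len (d v)) + c2"
      unfolding program_bound_def by blast
    then have "kn x \<le> len q + (i' + 2 + len (d v)) + c2" unfolding K_def using Kc_le order.trans by blast
    then show ?thesis using x(1) q(2) v(3) unfolding u_def by (intro bexI[of _ x]) simp_all
  qed
  then show ?thesis by blast
qed

end

section \<open>The main inequality\<close>

context universal_machine
begin

section \<open>Convergence of the approximations and choice of the level\<close>

lemma sum_programs_le:
  assumes "finite F" "F \<subseteq> {z. \<exists>x\<in>D. U (Str []) z = Some x}"
  shows "(\<Sum>z\<in>F. (1/2 :: real) ^ length z) \<le> 1"
proof (rule kraft_inequality[OF assms(1)])
  have "F \<subseteq> dom (U (Str []))" using assms(2) by auto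
  then show "prefix_free F" using prefix_free_dom[of "Str []"] unfolding prefix_free_def by blast
qed

lemma summable_programs:
  "(\<lambda>z. (1/2 :: real) ^ length z) summable_on {z. \<exists>x\<in>D. U (Str []) z = Some x}"
proof (rule nonneg_bdd_above_summable_on)
  show "bdd_above (sum (\<lambda>z. (1/2 :: real) ^ length z) `
      {F. F \<subseteq> {z. \<exists>x\<in>D. U (Str []) z = Some x} \<and> finite F})"
    using sum_programs_le by (intro bdd_aboveI[of _ 1]) blast
qed simp

lemma m_prob_le: "m_prob U D \<le> 1"
  unfolding m_prob_def by (intro infsum_le_finite_sums summable_programs sum_programs_le)

lemma eventually_into:
  assumes "U (Str []) z = Some x" "nat_of_str x \<in> set_decode s"
  shows "\<forall>\<^sub>F t in sequentially. nat_of_str z \<in> into t s"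
proof -
  obtain t0 where "st (nat_of_str z) t0 = Suc (nat_of_str x)"
    using st_complete[of "nat_of_str z" x] assms(1) by auto
  then have into: "nat_of_str z \<in> into t s" if "t \<ge> t0" "t > nat_of_str z" for t
    using st_mono[of "nat_of_str z" t0 "nat_of_str x" t] that assms(2) by (simp add: into_def)
  from eventually_ge_at_top[of t0] eventually_gt_at_top[of "nat_of_str z"] show ?thesis
    by eventually_elim (rule into)
qed

lemma m_prob_pos:
  assumes "D \<noteq> {}"
  shows "0 < m_prob U D"
proof -
  obtain x where "x \<in> D" using assms by blast
  obtain q t where "st q t = Suc (nat_of_str x)" by (rule K_attained)
  from st_sound[OF this] have "U (Str []) (str_of_nat q) = Some x" by simp
  with \<open>x \<in> D\<close> have "{str_of_nat q} \<subseteq> {z. \<exists>x\<in>D. U (Str []) z = Some x}" by auto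
  from finite_sum_le_infsum[OF summable_programs _ this]
  have "(1/2) ^ length (str_of_nat q) \<le> m_prob U D" by (simp add: m_prob_def)
  moreover have "(0::real) < (1/2) ^ length (str_of_nat q)" by simp
  ultimately show ?thesis by linarith
qed

text \<open>The positive infinite sum m(D) exceeds its half, so finitely many programs already reach
  that half, and all of them have halted from some stage on.\<close>

lemma eventually_weight_into:
  assumes "finite D" "D \<noteq> {}" and s: "set_decode s = nat_of_str ` D"
  shows "\<forall>\<^sub>F t in sequentially. m_prob U D / 2 \<le> weight (into t s)"
proof -
  define Z where "Z = {z. \<exists>x\<in>D. U (Str []) z = Some x}"
  have "\<exists>F. finite F \<and> F \<subseteq> Z \<and> m_prob U D / 2 \<le> (\<Sum>z\<in>F. (1/2) ^ length z)"
  proof (rule ccontr)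
    assume "\<not> ?thesis"
    then have "(\<Sum>z\<in>F. (1/2) ^ length z) \<le> m_prob U D / 2" if "finite F" "F \<subseteq> Z" for F
      using that by (meson linear)
    from infsum_le_finite_sums[OF summable_programs this[unfolded Z_def]]
    have "m_prob U D \<le> m_prob U D / 2" unfolding m_prob_def .
    with m_prob_pos[OF assms(2)] show False by simp
  qed
  then obtain F where F: "finite F" "F \<subseteq> Z" "m_prob U D / 2 \<le> (\<Sum>z\<in>F. (1/2) ^ length z)" by blast
  have inj: "inj_on nat_of_str F" by (rule inj_on_subset[OF bij_is_inj[OF bij_nat_of_str]]) simp
  have "\<forall>\<^sub>F t in sequentially. \<forall>z\<in>F. nat_of_str z \<in> into t s"
  proof (rule eventually_ball_finite[OF F(1)], rule ballI)
    fix z assume "z \<in> F"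
    with F(2) obtain x where "x \<in> D" "U (Str []) z = Some x" by (auto simp: Z_def)
    then show "\<forall>\<^sub>F t in sequentially. nat_of_str z \<in> into t s"
      by (intro eventually_into) (auto simp: s)
  qed
  then show ?thesis
  proof eventually_elim
    case (elim t)
    have "(\<Sum>z\<in>F. (1/2) ^ length z) = weight (nat_of_str ` F)"
      by (simp add: weight_def sum.reindex[OF inj])
    also have "\<dots> \<le> weight (into t s)" using elim by (intro weight_mono finite_into) auto
    finally show ?case using F(3) by simp
  qed
qed

lemma exists_settled: "\<exists>t. settled N t"
proof -
  define Q where "Q = {q. len q \<le> N \<and> halts q}"
  have "q < 2 ^ (N + 1)" if "q \<in> Q" for q
  proof -
    have "len q \<le> N" using that by (simp add: Q_def)
    then show ?thesis
      using len_bounds(2)[of q] power_increasing[of "len q + 1" "N + 1" "2::nat"] by linarith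
  qed
  then have "finite Q" by (intro finite_subset[of Q "{..<2 ^ (N + 1)}"]) auto
  moreover have "\<forall>q\<in>Q. \<forall>\<^sub>F t in sequentially. st q t \<noteq> 0"
  proof
    fix q assume "q \<in> Q"
    then have "halts q" by (simp add: Q_def)
    then obtain t0 where "st q t0 \<noteq> 0" unfolding halts_iff ..
    then obtain v where "st q t0 = Suc v" by (auto simp: gr0_conv_Suc)
    from st_mono[OF this] show "\<forall>\<^sub>F t in sequentially. st q t \<noteq> 0"
      unfolding eventually_sequentially by (intro exI[of _ t0]) simp
  qed
  ultimately have "\<forall>\<^sub>F t in sequentially. \<forall>q\<in>Q. st q t \<noteq> 0" by (rule eventually_ball_finite)
  then obtain t where "\<forall>q\<in>Q. st q t \<noteq> 0" by (auto simp: eventually_sequentially)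
  then show ?thesis unfolding settled_def Q_def by blast
qed

lemma settled_mono:
  assumes "settled N t" "t \<le> t'"
  shows "settled N t'"
  unfolding settled_def
proof (intro allI impI)
  fix q assume "len q \<le> N" "halts q"
  with assms(1) obtain v where "st q t = Suc v" unfolding settled_def by (metis not0_implies_Suc)
  from st_mono[OF this assms(2)] show "st q t' \<noteq> 0" by simp
qed

lemma exists_jump:
  fixes f :: "nat \<Rightarrow> nat"
  assumes "a \<le> b" "f a < f b"
  shows "\<exists>t\<ge>a. f t < f (Suc t)"
proof (rule ccontr)
  assume *: "\<not> ?thesis"
  from assms(1) have "f b \<le> f a"
    by (induction rule: dec_induct) (use * in \<open>auto simp: not_less intro: order.trans\<close>)
  with assms(2) show False by simp
qed

text \<open>For \<open>p \<in> hal i t\<close> choose \<open>n\<close> such that the weight enumerated from \<open>p\<close> on is about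
  \<open>2\<^sup>-\<^sup>n\<close>; then the weight crosses a multiple of \<open>2\<^sup>-\<^sup>n\<^sup>-\<^sup>1\<close> after that.\<close>

lemma exists_level:
  assumes "p \<in> hal i t"
  obtains n \<tau> t' where "p \<notin> hal i \<tau>" "\<tau> \<le> t'" "p \<in> hal i (Suc t')"
    "fl i (n + 1) t' < fl i (n + 1) (Suc t')"
    "\<forall>T. weight (hal i T) - weight (hal i \<tau>) \<le> (1/2) ^ n"
proof -
  define t1 where "t1 = (LEAST t. p \<in> hal i t)"
  have t1: "p \<in> hal i t1" unfolding t1_def using assms by (rule LeastI)
  then have "t1 \<noteq> 0" using hal_subset[of i t1] by (cases t1) auto
  define \<tau> where "\<tau> = t1 - 1"
  have Suc: "Suc \<tau> = t1" using \<open>t1 \<noteq> 0\<close> by (simp add: \<tau>_def)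
  have \<tau>: "p \<notin> hal i \<tau>" using not_less_Least[of \<tau> "\<lambda>t. p \<in> hal i t"] Suc by (simp add: t1_def[symmetric])
  \<comment> \<open>\<open>P n\<close>: the weight gained after \<tau> exceeds 2^-(n+1) at some
    stage. It holds for \<open>n = len p\<close>, because \<open>p\<close> itself is gained;
    minimality of \<open>n\<close> keeps the gain at most 2^-n at all stages.\<close>
  define P where "P n \<longleftrightarrow> (\<exists>T. 1 < 2 ^ (n + 1) * (weight (hal i T) - weight (hal i \<tau>)))" for n
  have "P (len p)"
  proof -
    have "(1/2) ^ len p = weight {p}" by (simp add: weight_def)
    also have "\<dots> \<le> weight (hal i t1 - hal i \<tau>)"
      using t1 \<tau> by (intro weight_mono finite_Diff finite_hal) simp
    also have "\<dots> = weight (hal i t1) - weight (hal i \<tau>)"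
      using Suc by (intro weight_Diff finite_hal hal_mono) simp
    finally have "2 ^ (len p + 1) * (1/2) ^ len p \<le> 2 ^ (len p + 1) * (weight (hal i t1) - weight (hal i \<tau>))"
      by (intro mult_left_mono) auto
    moreover have "2 ^ (len p + 1) * (1/2) ^ len p = (2::real)" by (simp add: power_one_over)
    ultimately show ?thesis unfolding P_def by (intro exI[of _ t1]) linarith
  qed
  define n where "n = (LEAST n. P n)"
  have "P n" unfolding n_def using \<open>P (len p)\<close> by (rule LeastI)
  then obtain T where T: "1 < 2 ^ (n + 1) * (weight (hal i T) - weight (hal i \<tau>))" by (auto simp: P_def)
  have small: "weight (hal i T) - weight (hal i \<tau>) \<le> (1/2) ^ n" for T
  proof (cases n)
    case 0
    have "0 \<le> weight (hal i \<tau>)" by (simp add: weight_def sum_nonneg)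
    then show ?thesis using weight_hal_le[of i T] 0 by simp
  next
    case (Suc m)
    then have "\<not> P m" using not_less_Least[of m P] by (simp add: n_def[symmetric])
    then have "2 ^ n * (weight (hal i T) - weight (hal i \<tau>)) \<le> 1" unfolding P_def Suc by (simp add: not_less)
    then show ?thesis by (simp add: power_one_over field_simps)
  qed
  define x y where "x = weight (hal i \<tau>) * 2 ^ (n + 1)" and "y = weight (hal i T) * 2 ^ (n + 1)"
  have "0 \<le> x" by (simp add: x_def weight_def sum_nonneg)
  \<comment> \<open>A gain of more than 1 on this scale increases the integer part, so
    \<open>fl\<close> jumps somewhere from \<tau> on.\<close>
  have "x + 1 < y" using T by (simp add: x_def y_def algebra_simps)
  then have "\<lfloor>x\<rfloor> < \<lfloor>y\<rfloor>" by linarith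
  then have less: "fl i (n + 1) \<tau> < fl i (n + 1) T"
    using \<open>0 \<le> x\<close> unfolding fl_eq_floor x_def[symmetric] y_def[symmetric]
    by (subst nat_less_eq_zless) simp_all
  then have "\<tau> \<le> T" using fl_mono[of T \<tau> i "n + 1"] by linarith
  from exists_jump[of \<tau> T "fl i (n + 1)", OF this less]
  obtain t' where t': "\<tau> \<le> t'" "fl i (n + 1) t' < fl i (n + 1) (Suc t')" by blast
  have "p \<in> hal i (Suc t')" using t1 hal_mono[of t1 "Suc t'" i] t'(1) Suc by auto
  from that[OF \<tau> t'(1) this t'(2)] small show thesis by blast
qed

section \<open>Combination of the two bounds and elimination of the level\<close>

lemma len_mono: "m \<le> n \<Longrightarrow> len m \<le> len n"
  using len_bounds(1)[of m] by (simp add: le_len_iff)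

text \<open>The jump stage \<open>Suc t'\<close> feeds both bounds: its low complexity makes the
  hitting set cheap, and it precedes the first settled stage, at which \<open>p\<close> can be
  compressed. The \<open>n\<close> of the statement is the level plus one, as the jump is seen in
  one more digit.\<close>

lemma main_bounds:
  "\<exists>c. \<forall>D. finite D \<and> D \<noteq> {} \<longrightarrow>
     (let i = nat \<lceil>- log 2 (m_prob U D)\<rceil> in
      \<exists>n. \<exists>x\<in>D. K U x \<le> i + n + 2 * len n + 2 * kn i + len (n + 2 * len n + 2 * kn i + c) + c \<and>
        int n \<le> I_halt U (encode_set D) + int (2 * len n + kn i + c))"
proof -
  obtain c1 where c1: "\<forall>i n t. fl i n t < fl i n (Suc t) \<longrightarrow> kn (Suc t) \<le> kn (pair n i) + n + c1"
    using K_stage ..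
  obtain c2 where c2: "\<And>a b. kn (pair a b) \<le> kn a + kn b + c2" using K_pair by blast
  obtain c3 where c3: "\<forall>x. kn x \<le> 2 * len x + c3" using K_le_len ..
  obtain C4 where C4: "\<forall>i n t. fl i n t < fl i n (Suc t) \<longrightarrow> \<not> settled (4 * n + 2 * i + C4) (Suc t)"
    using not_settled_stage ..
  \<comment> \<open>The 4 added to \<open>C4\<close> makes \<open>N n i\<close> the length that
    \<open>not_settled_stage\<close> gives for level \<open>n + 1\<close>, where the jump takes
    place.\<close>
  define N where "N n i = 4 * n + 2 * i + (C4 + 4)" for n i
  obtain c5 where c5: "\<And>i n p \<tau> t y. settled (N n i) t \<Longrightarrow> (\<forall>t'<t. \<not> settled (N n i) t') \<Longrightarrow>
     p \<in> hal i t \<Longrightarrow> \<tau> < t \<Longrightarrow> p \<notin> hal i \<tau> \<Longrightarrow>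
     weight (hal i t) - weight (hal i \<tau>) \<le> (1/2) ^ n \<Longrightarrow> st p t = Suc y \<Longrightarrow>
     Kc U (str_of_nat y) (Seq (halting_seq U)) \<le> kn (pair n i) + (len p - n) + c5"
    using Kc_halting_seq[of "C4 + 4"] unfolding N_def by blast
  obtain C6 c6 where c6: "\<forall>i t s p. codes i t p s \<longrightarrow> p < t \<longrightarrow> len p = kn (enc s) \<longrightarrow>
     (\<exists>x\<in>set_decode s. kn x \<le> i + kn (pair (pair t i) C6) + len (kn (pair (pair t i) C6) + C6) + c6)"
    using K_hitting by blast
  define c where "c = c1 + 3 * c2 + 2 * c3 + c5 + C6 + c6 + kn C6 + 2"
  have "\<exists>n. \<exists>x\<in>D. K U x \<le> i + n + 2 * len n + 2 * kn i + len (n + 2 * len n + 2 * kn i + c) + c \<and>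
        int n \<le> I_halt U (encode_set D) + int (2 * len n + kn i + c)"
    if D: "finite D" "D \<noteq> {}" and i: "i = nat \<lceil>- log 2 (m_prob U D)\<rceil>" for D i
  proof -
    define s where "s = set_encode (nat_of_str ` D)"
    have s: "set_decode s = nat_of_str ` D" using D(1) by (simp add: s_def)
    have enc: "str_of_nat (enc s) = encode_set D" using enc_set_encode[OF D(1)] by (simp add: s_def)
    obtain p t0 where p: "st p t0 = Suc (enc s)" "len p = kn (enc s)" by (rule K_attained)
    have m: "(1/2) ^ (i + 1) \<le> m_prob U D / 2"
    proof -
      have "- real i \<le> log 2 (m_prob U D)" unfolding i by linarith
      then have "2 powr (- real i) \<le> m_prob U D"
        using m_prob_pos[OF D(2)] by (simp add: le_log_iff)
      then show ?thesis by (simp add: powr_minus powr_realpow power_one_over inverse_eq_divide)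
    qed
    from eventually_weight_into[OF D s]
    have "\<forall>\<^sub>F t in sequentially. (1/2) ^ (i + 1) \<le> weight (into t s)"
      by eventually_elim (rule order.trans[OF m])
    with eventually_ge_at_top[of t0] eventually_gt_at_top[of s] eventually_gt_at_top[of p]
    have "\<forall>\<^sub>F t in sequentially. p \<in> hal i t"
    proof eventually_elim
      case (elim t)
      then have "codes i t p s" using st_mono[OF p(1)] by (simp add: codes_def)
      then show ?case using elim by (auto simp: hal_def)
    qed
    then obtain t where "p \<in> hal i t" by (auto simp: eventually_sequentially)
    then obtain n \<tau> t' where nt: "p \<notin> hal i \<tau>" "\<tau> \<le> t'" "p \<in> hal i (Suc t')"
      "fl i (n + 1) t' < fl i (n + 1) (Suc t')"
      "\<forall>T. weight (hal i T) - weight (hal i \<tau>) \<le> (1/2) ^ n"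
      by (rule exists_level)
    have codes: "codes i T p s" if hT: "p \<in> hal i T" for T
    proof -
      obtain s' where s': "codes i T p s'" using hT by (auto simp: hal_def)
      then have "st p T = Suc (enc s')" by (simp add: codes_def)
      from enc_inject[OF st_unique[OF this p(1)]] s' show ?thesis by simp
    qed
    define k where "k = kn i"
    have pair: "kn (pair n i) \<le> 2 * len (n + 1) + k + c2 + c3"
      "kn (pair (n + 1) i) \<le> 2 * len (n + 1) + k + c2 + c3"
      using c2[of n i] c2[of "n + 1" i] c3[rule_format, of n] c3[rule_format, of "n + 1"] len_mono[of n "n + 1"]
      unfolding k_def by linarith+
    define l where "l = kn (pair (pair (Suc t') i) C6)"
    have l: "l + C6 \<le> (n + 1) + 2 * len (n + 1) + 2 * k + c"
      using c2[of "pair (Suc t') i" C6] c2[of "Suc t'" i] c1[rule_format, OF nt(4)] pair(2)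
      unfolding l_def c_def k_def by linarith
    have "p < Suc t'" using nt(3) hal_subset by blast
    with codes[OF nt(3)] c6 p(2) obtain x where x: "x \<in> set_decode s" "kn x \<le> i + l + len (l + C6) + c6"
      unfolding l_def by blast
    define tb where "tb = (LEAST t. settled (N n i) t)"
    have tb: "settled (N n i) tb" unfolding tb_def using exists_settled by (rule LeastI_ex)
    have before: "\<forall>t<tb. \<not> settled (N n i) t" unfolding tb_def using not_less_Least by blast
    have "N n i = 4 * (n + 1) + 2 * i + C4" by (simp add: N_def)
    then have "\<not> settled (N n i) (Suc t')" using C4 nt(4) by metis
    then have late: "Suc t' < tb" using settled_mono[OF tb] by (meson not_less)
    then have ptb: "p \<in> hal i tb" using nt(3) hal_mono[of "Suc t'" tb i] by auto
    have "st p tb = Suc (enc s)" using codes[OF ptb] by (simp add: codes_def)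
    from c5[OF tb before ptb _ nt(1) nt(5)[rule_format] this] late nt(2)
    have Kc: "Kc U (encode_set D) (Seq (halting_seq U)) \<le> kn (pair n i) + (len p - n) + c5"
      by (simp add: enc)
    \<comment> \<open>Needed to read \<open>len p - n\<close> as a true difference when
      \<open>n\<close> is moved to the other side.\<close>
    have "n \<le> len p"
    proof -
      have "(1/2) ^ len p = weight {p}" by (simp add: weight_def)
      also have "\<dots> \<le> weight (hal i tb - hal i \<tau>)"
        using ptb nt(1) by (intro weight_mono finite_Diff finite_hal) simp
      also have "\<dots> = weight (hal i tb) - weight (hal i \<tau>)"
        using late nt(2) by (intro weight_Diff finite_hal hal_mono) simp
      also have "\<dots> \<le> (1/2) ^ n" using nt(5) by blast
      finally show ?thesis by simp
    qed
    moreover have "len p = K U (encode_set D)" using p(2) enc by simp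
    ultimately have I: "int (n + 1) \<le> I_halt U (encode_set D) + int (2 * len (n + 1) + k + c)"
      using Kc pair(1) unfolding I_halt_def c_def by linarith
    obtain x' where x': "x' \<in> D" "x = nat_of_str x'" using x(1) s by auto
    have "len (l + C6) \<le> len ((n + 1) + 2 * len (n + 1) + 2 * k + c)" by (rule len_mono[OF l])
    moreover have "l + c6 \<le> (n + 1) + 2 * len (n + 1) + 2 * k + c"
      using c2[of "pair (Suc t') i" C6] c2[of "Suc t'" i] c1[rule_format, OF nt(4)] pair(2)
      unfolding l_def c_def k_def by linarith
    ultimately have "K U x' \<le> i + (n + 1) + 2 * len (n + 1) + 2 * k +
        len ((n + 1) + 2 * len (n + 1) + 2 * k + c) + c"
      using x(2) x'(2) by simp
    with I x'(1) show ?thesis unfolding k_def by blast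
  qed
  then show ?thesis unfolding Let_def by blast
qed

text \<open>In the application \<open>k\<close> is K(i), which the error term contains anyway, so
  the crude \<open>log 2 k \<le> k\<close> loses nothing that matters.\<close>

lemma len_le_log:
  assumes "real n + 1 \<le> b * (a * real k)" "1 \<le> a" "1 \<le> b" "1 \<le> k"
  shows "len n \<le> log 2 b + log 2 a + k"
proof -
  have "real (2 ^ len n) \<le> real (n + 1)" unfolding of_nat_le_iff by (rule len_bounds(1))
  then have "2 powr len n \<le> b * (a * k)" using assms(1) by (simp add: powr_realpow)
  then have "len n \<le> log 2 (b * (a * k))"
    using assms by (subst le_log_iff) (auto intro!: mult_pos_pos)
  also have "\<dots> = log 2 b + log 2 a + log 2 k" using assms by (simp add: log_mult)
  also have "log 2 k \<le> k"
  proof -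
    have "real k \<le> real (2 ^ k)" unfolding of_nat_le_iff by (rule less_imp_le[OF less_exp])
    then have "real k \<le> 2 powr k" by (simp add: powr_realpow)
    then show ?thesis using assms(4) by (simp add: log_le_iff)
  qed
  finally show ?thesis by simp
qed

text \<open>The level occurs on both sides of its bound, through \<open>len n\<close> on the right.
  As \<open>4 * len n \<le> n + 8\<close>, half of \<open>n\<close> can be moved to the left; so
  \<open>n\<close> is linear in I(D:H) and K(i), and its logarithm fits into the error term.\<close>

lemma min_complexity_bound:
  "\<exists>c::real. \<forall>D. finite D \<and> D \<noteq> {} \<longrightarrow>
    real (MIN x\<in>D. K U x) <
      - log 2 (m_prob U D) + real_of_int (I_halt U (encode_set D))
      + c * (real (kn (nat \<lceil>- log 2 (m_prob U D)\<rceil>)) + log_plus (I_halt U (encode_set D)))"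
proof -
  obtain c where c: "\<And>D. finite D \<and> D \<noteq> {} \<Longrightarrow>
     (let i = nat \<lceil>- log 2 (m_prob U D)\<rceil> in
      \<exists>n. \<exists>x\<in>D. K U x \<le> i + n + 2 * len n + 2 * kn i + len (n + 2 * len n + 2 * kn i + c) + c \<and>
        int n \<le> I_halt U (encode_set D) + int (2 * len n + kn i + c))"
    using main_bounds by blast
  \<comment> \<open>Chosen so that \<open>b * (a * k)\<close> exceeds both \<open>n\<close> and
    \<open>Y\<close> below: they are linear in \<open>a\<close>, \<open>k\<close> and
    \<open>c\<close>, and \<open>a * k\<close> dominates \<open>a\<close>, \<open>k\<close> and 1
    because \<open>a\<close> and \<open>k\<close> are at least 1.\<close>
  define b where "b = 5 * real c + 31"
  define B where "B = log 2 b"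
  have "0 \<le> B" by (simp add: B_def b_def)
  \<comment> \<open>Five logarithms occur: \<open>2 * len n\<close> in the bound on K(x),
    \<open>2 * len n\<close> in the bound on \<open>n\<close>, and one \<open>len Y\<close>. Each
    contributes \<open>B\<close>, \<open>log_plus I\<close> and \<open>k\<close>; three further
    \<open>k\<close> make 8. The final 2 against the 1 lost in rounding \<open>i\<close> gives
    strict inequality.\<close>
  define c' where "c' = 5 * B + 8 + 2 * real c + 2"
  have "real (MIN x\<in>D. K U x) < - log 2 (m_prob U D) + real_of_int (I_halt U (encode_set D))
      + c' * (real (kn (nat \<lceil>- log 2 (m_prob U D)\<rceil>)) + log_plus (I_halt U (encode_set D)))"
    if D: "finite D" "D \<noteq> {}" for D
  proof -
    define i I where "i = nat \<lceil>- log 2 (m_prob U D)\<rceil>" and "I = I_halt U (encode_set D)"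
    obtain n x where x: "x \<in> D"
      "K U x \<le> i + n + 2 * len n + 2 * kn i + len (n + 2 * len n + 2 * kn i + c) + c"
      and n: "int n \<le> I + int (2 * len n + kn i + c)"
      using c[of D] D unfolding Let_def i_def[symmetric] I_def[symmetric] by blast
    define Y where "Y = n + 2 * len n + 2 * kn i + c"
    define k where "k = real (kn i)"
    define a where "a = max 1 (real_of_int I)"
    have k: "1 \<le> k" using K_pos[of i] by (simp add: k_def)
    have a: "1 \<le> a" "I \<le> a" by (simp_all add: a_def)
    have n: "real n \<le> I + (2 * real (len n) + k + c)"
    proof -
      have "real_of_int (int n) \<le> real_of_int (I + int (2 * len n + kn i + c))" using n by (simp only: of_int_le_iff)
      then show ?thesis by (simp add: k_def)
    qed
    have four: "4 * real (len n) \<le> n + 8" using four_len_le[of n] by linarith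
    have ak: "a \<le> a * k" "k \<le> a * k" "1 \<le> a * k"
      using a(1) k mult_mono[of 1 a 1 k] by (simp_all add: mult_le_cancel_left1 mult_le_cancel_right1)
    have "real c \<le> c * (a * k)" using ak(3) by (simp add: mult_le_cancel_left1)
    with n four a(2) ak have "real n + 1 \<le> b * (a * k)" "real Y + 1 \<le> b * (a * k)"
      unfolding b_def Y_def k_def[symmetric] distrib_right by (simp_all add: k_def[symmetric])
    then have len: "len n \<le> B + log_plus I + k" "len Y \<le> B + log_plus I + k"
      using len_le_log[of n b a "kn i"] len_le_log[of Y b a "kn i"] a(1) K_pos[of i]
      unfolding B_def log_plus_def a_def[symmetric] k_def by (simp_all add: b_def)
    have L: "0 \<le> log_plus I" by (simp add: log_plus_def)
    have "real i \<le> - log 2 (m_prob U D) + 1"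
    proof -
      have "log 2 (m_prob U D) \<le> 0" using m_prob_le[of D] m_prob_pos[OF D(2)] by simp
      then show ?thesis unfolding i_def by linarith
    qed
    moreover have "(MIN x\<in>D. K U x) \<le> K U x" using D(1) x(1) by (intro Min_le) auto
    then have "real (MIN x\<in>D. K U x) \<le> i + n + 2 * real (len n) + 2 * k + len Y + c"
      using x(2) unfolding Y_def[symmetric] k_def by linarith
    ultimately have "real (MIN x\<in>D. K U x) \<le> - log 2 (m_prob U D) + I + 5 * B + 5 * log_plus I + 8 * k + 2 * c + 1"
      using n len by linarith
    also have "\<dots> < - log 2 (m_prob U D) + I + c' * (k + log_plus I)"
    proof -
      have "(5 * B + 2 * real c + 2) * 1 \<le> (5 * B + 2 * real c + 2) * (k + log_plus I)"
        using \<open>0 \<le> B\<close> k L by (intro mult_left_mono) auto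
      then show ?thesis using L unfolding c'_def by (simp add: algebra_simps)
    qed
    finally show ?thesis unfolding k_def i_def I_def .
  qed
  then show ?thesis by blast
qed

end

theorem theorem2:
  fixes U :: machine
  assumes "universal U" and "left_total_machine U"
  shows "\<exists>c::real. \<forall>D::str set. finite D \<and> D \<noteq> {} \<longrightarrow>
    real (MIN x\<in>D. K U x) <
      - log 2 (m_prob U D) + real_of_int (I_halt U (encode_set D))
      + c * (real (K U (str_of_nat (nat \<lceil>- log 2 (m_prob U D)\<rceil>)))
             + log_plus (I_halt U (encode_set D)))"
  by (rule universal_machine.min_complexity_bound) (unfold_locales, rule assms(1))

end
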